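(* Let $m,p$ be mutually prime positive integers and let $L$ be the $(m,p)$ torus knot. The hyperbolic specification $\langle L\rangle_k$ of the colored Jones invariant of $L$ has the following asymptotic expansion as $k\to\infty$ ($k$ a positive integer): $$\langle L\rangle_{k}\, e^{\frac{i\pi}{2k}\left(\frac{m}{p}+\frac{p}{m}\right)}=\sum_{j=1}^{mp-1}\langle L\rangle_{k}^{(j)}+\langle L\rangle_{k}^{(\infty)},$$ where $$\langle L\rangle_{k}^{(j)}=2\,(2mp/k)^{-3/2}\,e^{i\pi/4}\,(-1)^{(k-1)j}\,e^{-i\frac{\pi k j^2}{2mp}}\,j^2\,\sin(\pi j/m)\,\sin(\pi j/p)$$ and $\langle L\rangle_k^{(\infty)}$ is the asymptotic series $$\langle L\rangle_{k}^{(\infty)}=\frac14\,e^{i\pi k m p/2}\sum_{n\ge 1}\frac1{n!}\left(\frac{i\pi}{2kmp}\right)^{n-1}\left.\frac{\partial^{2n}\bigl(x\,\tau_L(x)\bigr)}{\partial x^{2n}}\right|_{x=0}.$$ That is, for every integer $N\ge 1$, as $k\to\infty$, $$\langle L\rangle_{k}\, e^{\frac{i\pi}{2k}\left(\frac{m}{p}+\frac{p}{m}\right)}=\sum_{j=1}^{mp-1}\langle L\rangle_{k}^{(j)}+\frac14\,e^{i\pi k m p/2}\sum_{n=1}^{N}\frac1{n!}\left(\frac{i\pi}{2kmp}\right)^{n-1}\left.\frac{\partial^{2n}\bigl(x\,\tau_L(x)\bigr)}{\partial x^{2n}}\right|_{x=0}+O(k^{-N}).$$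
   Context: Here $i=\sqrt{-1}$. $L$ is the $(m,p)$ torus knot obtained as the $(m,p)$ cable about the unknot $O$ with zero framing. For a positive integer $k$ (the color, the dimension of an $SU(2)_q$-module, $q=e^h$), the colored Jones invariant of $O$ is $J_{O,k}(h)=\sinh(kh/2)/\sinh(h/2)$, and the colored Jones invariant $J_{L,k}(h)$ of $L$ is given by the explicit formula $$2\sinh(kh/2)\,\frac{J_{L,k}(h)}{J_{O,k}(h)}=\sum_{\epsilon=\pm1}\ \sum_{r=-(k-1)/2}^{(k-1)/2}\epsilon\, e^{hmpr^2+hr(m+\epsilon p)+\epsilon h/2},$$ where $r$ runs from $-(k-1)/2$ to $(k-1)/2$ in steps of $1$. The hyperbolic specification is $$\langle L\rangle_{k}=\lim_{h\to 2\pi i/k}\frac{J_{L,k}(h)}{J_{O,k}(h)}.$$ The function $\tau_L$ is $$\tau_L(z)=\frac{2\sinh(mz)\sinh(pz)}{\sinh(mpz)},$$ regarded as a meromorphic function on $\mathbb{C}$ with removable singularities removed (in particular it is holomorphic at $0$). *)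

theory Defs
  imports "HOL-Complex_Analysis.Complex_Analysis" "HOL-Library.Landau_Symbols"
begin

definition J_unknot :: "nat \<Rightarrow> complex \<Rightarrow> complex" where
  "J_unknot k h = sinh (of_nat k * h / 2) / sinh (h / 2)"

(* The index r = -(k-1)/2, ..., (k-1)/2 (steps of 1) is written r = l - (k-1)/2 with l < k. *)
definition torus_sum :: "nat \<Rightarrow> nat \<Rightarrow> nat \<Rightarrow> complex \<Rightarrow> complex" where
  "torus_sum m p k h =
     (\<Sum>\<epsilon>\<in>{1, -1}. \<Sum>l<k. let r = of_nat l - (of_nat k - 1) / 2 in
        \<epsilon> * exp (h * of_nat m * of_nat p * r\<^sup>2 + h * r * (of_nat m + \<epsilon> * of_nat p) + \<epsilon> * h / 2))"

(* The explicit formula for the (m,p) torus knot, solved for J; see J_torus_formula.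
   Division by zero only affects isolated values of h. *)
definition J_torus :: "nat \<Rightarrow> nat \<Rightarrow> nat \<Rightarrow> complex \<Rightarrow> complex" where
  "J_torus m p k h = J_unknot k h * (torus_sum m p k h / (2 * sinh (of_nat k * h / 2)))"

lemma J_torus_formula:
  assumes "sinh (of_nat k * h / 2) \<noteq> 0" "sinh (h / 2) \<noteq> 0"
  shows "2 * sinh (of_nat k * h / 2) * (J_torus m p k h / J_unknot k h) = torus_sum m p k h"
  using assms by (simp add: J_torus_def J_unknot_def)

(* A limit over the punctured neighbourhood: sinh (k h / 2) vanishes at h = 2 pi i / k itself. *)
definition hyp_spec :: "nat \<Rightarrow> nat \<Rightarrow> nat \<Rightarrow> complex" where
  "hyp_spec m p k =
     Lim (at (2 * of_real pi * \<i> / of_nat k)) (\<lambda>h. J_torus m p k h / J_unknot k h)"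

definition torus_tau :: "nat \<Rightarrow> nat \<Rightarrow> complex \<Rightarrow> complex" where
  "torus_tau m p = remove_sings
     (\<lambda>z. 2 * sinh (of_nat m * z) * sinh (of_nat p * z) / sinh (of_nat m * of_nat p * z))"

definition hyp_spec_term :: "nat \<Rightarrow> nat \<Rightarrow> nat \<Rightarrow> nat \<Rightarrow> complex" where
  "hyp_spec_term m p k j =
     2 * of_real ((2 * real m * real p / real k) powr (-3/2)) * exp (\<i> * of_real pi / 4)
       * (-1) ^ ((k - 1) * j)
       * exp (- (\<i> * of_real pi * of_nat k * (of_nat j)\<^sup>2 / (2 * of_nat m * of_nat p)))
       * (of_nat j)\<^sup>2
       * of_real (sin (pi * real j / real m)) * of_real (sin (pi * real j / real p))"

definition hyp_spec_inf_partial :: "nat \<Rightarrow> nat \<Rightarrow> nat \<Rightarrow> nat \<Rightarrow> complex" where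
  "hyp_spec_inf_partial m p N k =
     1 / 4 * exp (\<i> * of_real pi * of_nat k * of_nat m * of_nat p / 2) *
     (\<Sum>n=1..N. 1 / fact n * (\<i> * of_real pi / (2 * of_nat k * of_nat m * of_nat p)) ^ (n - 1)
        * (deriv ^^ (2 * n)) (\<lambda>x. x * torus_tau m p x) 0)"

end

theory Submission
  imports Defs "HOL-Number_Theory.Cong" "HOL-Probability.Distributions" "HOL-Real_Asymp.Real_Asymp"
begin

text \<open>
Completing the square in the exponents of the defining sum turns the hyperbolic specification, times
the exponential factor of the theorem, into a quadratic Gauss sum. Write \<open>S g\<close> for the signed sum of
\<open>g x\<close> over the integers \<open>x\<close> in two progressions modulo \<open>2 m p\<close>, and \<open>e(x)\<close> for
\<open>exp (\<i> pi x^2 / (2 m p k))\<close>. The limit defining the specification is of type \<open>0 / 0\<close>: the signed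
sum \<open>S e\<close> vanishes, because multiplication by a unit \<open>u\<close> with \<open>u^2 = 1\<close> exchanges the two progressions
(\<open>gauss_sums_equal\<close>). Its value is therefore a derivative, a multiple of
\<open>X = S (\<lambda>x. x^2 e(x))\<close> (\<open>hyp_spec_eq_quadratic_gauss_sum\<close>).

Each \<open>x^2 e(x)\<close> comes from a Gaussian integral of \<open>w^2 exp (x w)\<close> over the line through \<open>0\<close> in
direction \<open>\<omega> = exp (\<i> pi / 4)\<close>. Under the integral the sum over \<open>x\<close> is geometric, and with
\<open>K = m p k / (2 pi)\<close> the result is, up to a factor,
\<open>X = \<integral> w^2 \<tau>(w) exp (\<i> K (w - pi \<i>)^2) dw\<close> (\<open>quadratic_gauss_sum_eq_integral\<close>).
The exponent has its saddle point at \<open>pi \<i>\<close>, not at \<open>0\<close>. Moving the line up to \<open>pi \<i>\<close>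
(\<open>knot_contour_shift\<close>) crosses the poles \<open>pi \<i> j / (m p)\<close>, \<open>0 < j < m p\<close>, of \<open>\<tau>\<close>, and the residue
at the \<open>j\<close>-th one is exactly the \<open>j\<close>-th term of the finite sum (\<open>residue_contribution\<close>).

On the shifted line \<open>\<tau> (w + pi \<i>) = - \<tau> w\<close>, and of the factor \<open>(w + pi \<i>)^2\<close> only the cross term
\<open>2 pi \<i> w\<close> survives integration against the odd function \<open>\<tau>\<close>. What remains is a Gaussian integral of the
even function \<open>w \<tau>(w)\<close>. Integrating its Taylor polynomial at \<open>0\<close> gives the partial sum of the asymptotic
series, and the remainder is bounded by a Gaussian moment (\<open>saddle_expansion\<close>), which is Watson's lemma.
\<close>


section \<open>Vanishing of a signed quadratic Gauss sum\<close>

text \<open>The full part of \<open>n\<close> built from primes dividing \<open>a\<close> splits off as a coprime factor: repeatedly extract \<open>gcd a n\<close>.\<close>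

lemma coprime_part_decomposition:
  fixes a n :: nat
  assumes "n > 0"
  shows "\<exists>M1 M2 e. n = M1 * M2 \<and> M1 dvd a ^ e \<and> coprime a M2"
  using assms
proof (induction n rule: less_induct)
  case (less n)
  show ?case
  proof (cases "coprime a n")
    case True
    then show ?thesis by (intro exI[of _ 1] exI[of _ n] exI[of _ 0]) auto
  next
    case False
    define g where "g = gcd a n"
    have g: "g > 1" using False less.prems unfolding g_def coprime_iff_gcd_eq_1
      by (metis gcd_pos_nat less_one linorder_neqE_nat nat_neq_iff)
    obtain n' where n': "n = g * n'" unfolding g_def by (meson dvdE gcd_dvd2)
    have "n' < n" "n' > 0" using n' g less.prems by auto
    from less.IH[OF this] obtain M1 M2 e where *: "n' = M1 * M2" "M1 dvd a ^ e" "coprime a M2"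
      by blast
    have "g * M1 dvd a ^ Suc e"
      unfolding power_Suc by (rule mult_dvd_mono) (use * g_def in auto)
    then show ?thesis using * n' by (intro exI[of _ "g * M1"] exI[of _ M2] exI[of _ "Suc e"]) auto
  qed
qed

text \<open>By the Chinese remainder theorem one may choose the sign \<open>1\<close> on the part of \<open>4 a b k\<close> supported on the primes of \<open>a\<close> and the sign \<open>-1\<close> on the complementary part. Oddness of \<open>a\<close> puts the factor \<open>4\<close> into the latter, which is what yields \<open>2 b\<close> instead of \<open>b\<close>.\<close>

lemma square_root_of_unity_mixed_sign:
  fixes a b k :: nat
  assumes "odd a" "coprime a b" "b > 0" "k > 0"
  shows "\<exists>u::int. [u * u = 1] (mod (4 * int a * int b * int k)) \<and> int a dvd u - 1 \<and> 2 * int b dvd u + 1"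
proof -
  have a: "a > 0" using \<open>odd a\<close> by (auto intro: Nat.gr0I)
  obtain M1 M2 e where M: "4 * b * k = M1 * M2" "M1 dvd a ^ e" "coprime a M2"
    using coprime_part_decomposition[of "4*b*k" a] assms by auto
  have cop1: "coprime M1 c" if "coprime a c" for c
    using that M(2) by (meson coprime_divisors coprime_power_left_iff dvd_refl)
  have "coprime a 2" using \<open>odd a\<close> by simp
  hence "coprime a (2 * 2 * b)" using \<open>coprime a b\<close> unfolding coprime_mult_right_iff by blast
  hence "coprime a (4 * b)" by simp
  hence "coprime M1 (4 * b)" by (rule cop1)
  moreover have "4 * b dvd M1 * M2" unfolding M(1)[symmetric] by simp
  ultimately have "4 * b dvd M2"
    using coprime_dvd_mult_right_iff[of "4 * b" M1 M2] by (simp only: coprime_commute)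
  moreover have "2 * b dvd 4 * b" by (rule dvdI[of _ _ 2]) simp
  ultimately have b2: "2 * b dvd M2" by (rule dvd_trans[rotated])
  have cop: "coprime (int (a * M1)) (int M2)"
    using M(3) cop1[OF M(3)] by (simp add: coprime_mult_left_iff)
  obtain u where u: "[u = 1] (mod int (a * M1))" "[u = -1] (mod int M2)"
    using binary_chinese_remainder_int[OF cop, of 1 "-1"] by blast
  have "[u * u = 1 * 1] (mod int (a * M1))" by (rule cong_mult) (use u in auto)
  moreover have "[u * u = (-1) * (-1)] (mod int M2)" by (rule cong_mult) (use u in auto)
  ultimately have sq: "[u * u = 1] (mod (int (a * M1) * int M2))"
    using coprime_cong_mult[OF _ _ cop, of "u * u" 1] by simp
  have "int (a * M1) * int M2 = int a * int (M1 * M2)" by simp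
  also have "\<dots> = 4 * int a * int b * int k" unfolding M(1)[symmetric] by simp
  finally have "int (a * M1) * int M2 = 4 * int a * int b * int k" .
  from sq[unfolded this] have "[u * u = 1] (mod 4 * int a * int b * int k)" .
  moreover have "int a dvd u - 1"
  proof -
    have "int (a * M1) dvd u - 1" using u(1) by (simp add: cong_iff_dvd_diff)
    thus ?thesis by (simp add: dvd_mult_left)
  qed
  moreover have "2 * int b dvd u + 1"
  proof -
    have "int M2 dvd u + 1" using u(2) by (simp add: cong_iff_dvd_diff)
    moreover have "int (2 * b) dvd int M2" using b2 by presburger
    ultimately have "int (2 * b) dvd u + 1" by (rule dvd_trans[rotated])
    thus ?thesis by simp
  qed
  ultimately show ?thesis by blast
qed

lemma cis_square_cong:
  fixes x y M :: int
  assumes "M > 0" "[x\<^sup>2 = y\<^sup>2] (mod (2 * M))"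
  shows "cis (pi * of_int (x\<^sup>2) / of_int M) = cis (pi * of_int (y\<^sup>2) / of_int M)"
proof -
  obtain c where c: "x\<^sup>2 = y\<^sup>2 + 2 * M * c"
    using assms(2) by (metis cong_iff_lin cong_sym)
  have "pi * of_int (x\<^sup>2) / of_int M = pi * of_int (y\<^sup>2) / of_int M + 2 * pi * of_int c"
    unfolding c using assms(1) by (simp add: field_simps)
  thus ?thesis using assms(1)
    by (metis cis_mult cis_multiple_2pi Ints_of_int mult.right_neutral)
qed

text \<open>The summand depends only on \<open>x^2\<close> modulo \<open>2 N\<close>, hence only on \<open>x\<close> modulo \<open>N\<close>, and inside the integers modulo \<open>N\<close> each sum runs over a full residue class modulo \<open>2 m p\<close>. A square root \<open>u\<close> of \<open>1\<close> with \<open>u = 1\<close> modulo \<open>p\<close> and \<open>u = -1\<close> modulo \<open>m\<close> maps the first class onto the second, since \<open>A\<close> vanishes modulo \<open>m\<close>, while preserving all squares.\<close>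

lemma gauss_sums_equal:
  fixes m p k :: nat and A :: int
  assumes "m > 0" "p > 0" "k > 0" "coprime m p" "int m dvd A"
  defines "N \<equiv> 2 * int m * int p * int k"
  defines "g \<equiv> (\<lambda>x::int. cis (pi * of_int (x\<^sup>2) / of_int N))"
  shows "(\<Sum>l<k. g (A + int p + 2 * int m * int p * int l)) =
         (\<Sum>l<k. g (A - int p + 2 * int m * int p * int l))"
proof -
  have N: "N > 0" using assms by simp
  \<comment> \<open>The modulus on which \<open>u = 1\<close> is prescribed has to be odd. If only \<open>m\<close> is odd, the roles of \<open>m\<close> and \<open>p\<close> are exchanged and \<open>- u\<close> is taken.\<close>
  have "odd m \<or> odd p" 
  proof (rule ccontr)
    assume "\<not> (odd m \<or> odd p)"
    hence "is_unit (2::nat)" using coprime_common_divisor[OF \<open>coprime m p\<close>, of 2] by blast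
    thus False by simp
  qed
  then obtain u where u: "[u * u = 1] (mod (2 * N))" and
    d1: "2 * int m * int p dvd u * (A + int p) - (A - int p)"
  proof
    assume "odd p"
    then obtain u where u: "[u * u = 1] (mod (4 * int p * int m * int k))"
        "int p dvd u - 1" "2 * int m dvd u + 1"
      using square_root_of_unity_mixed_sign[of p m k] assms by (auto simp: coprime_commute)
    have "int p dvd u * (A + int p) - (A - int p)"
    proof -
      have "u * (A + int p) - (A - int p) = (u - 1) * (A + int p) + 2 * int p" by (simp add: algebra_simps)
      thus ?thesis using u(2) by (metis dvd_add dvd_mult dvd_mult2 dvd_refl)
    qed
    moreover have "2 * int m dvd u * (A + int p) - (A - int p)"
    proof -
      have "u * (A + int p) - (A - int p) = (u + 1) * (A + int p) - 2 * A" by (simp add: algebra_simps)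
      moreover have "2 * int m dvd 2 * A" using assms by simp
      ultimately show ?thesis using u(3) by (metis dvd_diff dvd_mult2)
    qed
    moreover have "coprime (2 * int m) (int p)"
      using \<open>odd p\<close> assms by (simp add: coprime_mult_left_iff)
    ultimately have "2 * int m * int p dvd u * (A + int p) - (A - int p)"
      by (simp add: divides_mult)
    thus ?thesis using that u(1) by (auto simp: N_def ac_simps)
  next
    assume "odd m"
    then obtain u where u: "[u * u = 1] (mod (4 * int m * int p * int k))"
        "int m dvd u - 1" "2 * int p dvd u + 1"
      using square_root_of_unity_mixed_sign[of m p k] assms by auto
    have "int m dvd (-u) * (A + int p) - (A - int p)"
    proof -
      have "(-u) * (A + int p) - (A - int p) = - ((u - 1) * (A + int p)) - 2 * A" by (simp add: algebra_simps)
      thus ?thesis using u(2) assms by (metis dvd_diff dvd_minus_iff dvd_mult dvd_mult2)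
    qed
    moreover have "2 * int p dvd (-u) * (A + int p) - (A - int p)"
    proof -
      have "(-u) * (A + int p) - (A - int p) = - ((u + 1) * (A + int p)) + 2 * int p" by (simp add: algebra_simps)
      thus ?thesis using u(3) by (metis dvd_add dvd_minus_iff dvd_mult2 dvd_refl)
    qed
    moreover have "coprime (int m) (2 * int p)"
      using \<open>odd m\<close> assms by (simp add: coprime_mult_right_iff)
    ultimately have "int m * (2 * int p) dvd (-u) * (A + int p) - (A - int p)"
      by (simp add: divides_mult)
    hence "2 * int m * int p dvd (-u) * (A + int p) - (A - int p)" by (simp add: ac_simps)
    moreover have "[(-u) * (-u) = 1] (mod (2 * N))" using u(1) by (simp add: N_def ac_simps)
    ultimately show ?thesis using that by blast
  qed
  define d where "d = 2 * int m * int p"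
  have dN: "N = d * int k" by (simp add: N_def d_def)
  obtain c where c: "u * (A + int p) - (A - int p) = d * c" using d1 by (auto simp: d_def)
  \<comment> \<open>\<open>\<sigma>\<close> is multiplication by \<open>u\<close>, read off on the indices of the two progressions.\<close>
  define \<sigma> where "\<sigma> l = nat ((u * int l + c) mod int k)" for l
  have sig: "int (\<sigma> l) = (u * int l + c) mod int k" for l
    unfolding \<sigma>_def using \<open>k > 0\<close> by simp
  have g1: "g (A - int p + d * int (\<sigma> l)) = g (A + int p + d * int l)" for l
  proof -
    define q where "q = (u * int l + c) div int k"
    have s: "int (\<sigma> l) = u * int l + c - int k * q"
      unfolding sig q_def by (metis minus_mult_div_eq_mod)
    have eq: "A - int p + d * int (\<sigma> l) = u * (A + int p + d * int l) - N * q"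
      unfolding s dN using c by (simp add: algebra_simps)
    have "2 * N dvd (A - int p + d * int (\<sigma> l))\<^sup>2 - (u * (A + int p + d * int l))\<^sup>2"
    proof -
      have *: "(X - N * q)\<^sup>2 - X\<^sup>2 = 2 * N * (int m * int p * int k * q\<^sup>2 - X * q)" for X
        by (simp add: N_def power2_eq_square algebra_simps)
      show ?thesis unfolding eq * by simp
    qed
    hence 1: "[(A - int p + d * int (\<sigma> l))\<^sup>2 = (u * (A + int p + d * int l))\<^sup>2] (mod (2 * N))"
      by (simp add: cong_iff_dvd_diff)
    have "[(u * u) * (A + int p + d * int l)\<^sup>2 = 1 * (A + int p + d * int l)\<^sup>2] (mod (2 * N))"
      by (rule cong_mult[OF u cong_refl])
    hence "[(u * (A + int p + d * int l))\<^sup>2 = (A + int p + d * int l)\<^sup>2] (mod (2 * N))"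
      by (simp add: power2_eq_square ac_simps)
    from cong_trans[OF 1 this] show ?thesis unfolding g_def by (rule cis_square_cong[OF N])
  qed
  have inj: "inj_on \<sigma> {..<k}"
  proof (rule inj_onI)
    fix x y assume xy: "x \<in> {..<k}" "y \<in> {..<k}" "\<sigma> x = \<sigma> y"
    have "[u * int x + c = u * int y + c] (mod int k)"
      using xy(3) sig[of x] sig[of y] by (simp add: cong_def)
    hence "[u * int x = u * int y] (mod int k)" by (simp add: cong_add_rcancel)
    moreover have "coprime u (int k)"
    proof -
      have "[u * u = 1] (mod int k)" using u by (rule cong_dvd_modulus) (simp add: N_def)
      thus ?thesis using coprime_iff_invertible_int by blast
    qed
    ultimately have "[int x = int y] (mod int k)" using cong_mult_lcancel by blast
    thus "x = y" using xy(1,2) by (simp add: cong_def)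
  qed
  have "\<sigma> ` {..<k} \<subseteq> {..<k}"
  proof (intro image_subsetI)
    fix l
    have "int (\<sigma> l) < int k" unfolding sig using \<open>k > 0\<close> by simp
    thus "\<sigma> l \<in> {..<k}" by simp
  qed
  hence "\<sigma> ` {..<k} = {..<k}" using inj by (simp add: endo_inj_surj)
  hence "(\<Sum>l<k. g (A - int p + d * int l)) = (\<Sum>l<k. g (A - int p + d * int (\<sigma> l)))"
    using inj by (metis (no_types, lifting) sum.reindex_cong)
  thus ?thesis unfolding g1 by (simp add: d_def)
qed


section \<open>The hyperbolic specification as a Gauss sum\<close>

text \<open>With \<open>r = l - (k-1)/2\<close> this is \<open>2 m p (r + (m + s p) / (2 m p))\<close>: the square in the exponent of the knot sum, scaled so that it becomes an integer even if \<open>r\<close> is a half-integer.\<close>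

definition knot_exponent :: "nat \<Rightarrow> nat \<Rightarrow> nat \<Rightarrow> int \<Rightarrow> nat \<Rightarrow> int" where
  "knot_exponent m p k s l = int m - int m * int p * (int k - 1) + s * int p + 2 * int m * int p * int l"

definition signed_sum :: "nat \<Rightarrow> nat \<Rightarrow> nat \<Rightarrow> (int \<Rightarrow> complex) \<Rightarrow> complex" where
  "signed_sum m p k f = (\<Sum>l<k. f (knot_exponent m p k 1 l)) - (\<Sum>l<k. f (knot_exponent m p k (-1) l))"

lemma signed_sum_cmult: "signed_sum m p k (\<lambda>x. c * f x) = c * signed_sum m p k f"
  by (simp add: signed_sum_def sum_distrib_left right_diff_distrib)

lemma signed_sum_add: "signed_sum m p k (\<lambda>x. f x + g x) = signed_sum m p k f + signed_sum m p k g"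
  by (simp add: signed_sum_def sum.distrib)

lemma torus_sum_complete_square:
  assumes "m > 0" "p > 0"
  defines "c \<equiv> (of_nat m / of_nat p + of_nat p / of_nat m) / 4 :: complex"
  shows "torus_sum m p k h =
    signed_sum m p k (\<lambda>x. exp (h * (of_int x ^ 2 / (4 * of_nat m * of_nat p) - c)))"
proof -
  have *: "h * of_nat m * of_nat p * r\<^sup>2 + h * r * (of_nat m + of_int s * of_nat p) + of_int s * h / 2
     = h * (of_int (knot_exponent m p k s l) ^ 2 / (4 * of_nat m * of_nat p) - c)"
    if "r = of_nat l - (of_nat k - 1) / 2" "s = 1 \<or> s = -1" for r l s
  proof -
    have x: "of_int (knot_exponent m p k s l) = (2 * of_nat m * of_nat p * r + of_nat m + of_int s * of_nat p :: complex)"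
      unfolding that(1) knot_exponent_def by (simp add: field_simps)
    show ?thesis unfolding x c_def using assms that(2)
      by (elim disjE) (simp_all add: field_simps power2_eq_square)
  qed
  have 1: "torus_sum m p k h =
     (\<Sum>l<k. exp (h * (of_int (knot_exponent m p k 1 l) ^ 2 / (4 * of_nat m * of_nat p) - c))) +
     (\<Sum>l<k. - exp (h * (of_int (knot_exponent m p k (-1) l) ^ 2 / (4 * of_nat m * of_nat p) - c)))"
    unfolding torus_sum_def Let_def
    using *[OF refl, of 1] *[OF refl, of "-1"] by (simp add: sum_negf)
  show ?thesis unfolding 1 signed_sum_def by (simp add: sum_negf)
qed

lemma signed_gauss_sum_vanishes:
  assumes "m > 0" "p > 0" "k > 0" "coprime m p"
  shows "signed_sum m p k (\<lambda>x. cis (pi * of_int x ^ 2 / (2 * real m * real p * real k))) = 0"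
  using gauss_sums_equal[OF assms, of "int m - int m * int p * (int k - 1)"]
  by (simp add: signed_sum_def knot_exponent_def)

text \<open>Numerator and denominator both vanish at \<open>h = 2 pi \<i> / k\<close>, so the limit is the quotient of their derivatives. The derivative of the completed-square form differs from \<open>X\<close> only by a multiple of the vanishing sum, and the constant \<open>c\<close> split off by completing the square is the one compensated by the exponential factor.\<close>

lemma hyp_spec_eq_quadratic_gauss_sum:
  assumes "m > 0" "p > 0" "k > 1" "coprime m p"
  shows "hyp_spec m p k * exp (\<i> * of_real pi / (2 * of_nat k) * (of_nat m / of_nat p + of_nat p / of_nat m)) =
    - 1 / (4 * of_nat m * of_nat p * of_nat k) *
      signed_sum m p k (\<lambda>x. of_int x ^ 2 * cis (pi * of_int x ^ 2 / (2 * real m * real p * real k)))"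
proof -
  define h0 where "h0 = 2 * of_real pi * \<i> / of_nat k"
  define c where "c = (of_nat m / of_nat p + of_nat p / of_nat m) / (4 :: complex)"
  define q where "q x = of_int x ^ 2 / (4 * of_nat m * of_nat p) - c" for x
  define X where "X = signed_sum m p k (\<lambda>x. of_int x ^ 2 * cis (pi * of_int x ^ 2 / (2 * real m * real p * real k)))"
  have k: "of_nat k \<noteq> (0::complex)" using assms by simp
  have T: "torus_sum m p k h = signed_sum m p k (\<lambda>x. exp (h * q x))" for h
    unfolding torus_sum_complete_square[OF assms(1,2)] q_def c_def ..
  have e: "exp (h0 * q x) = exp (- h0 * c) * cis (pi * of_int x ^ 2 / (2 * real m * real p * real k))" for x
    unfolding cis_conv_exp exp_add[symmetric] q_def h0_def
    by (rule arg_cong[of _ _ exp]) (use assms in \<open>simp add: field_simps\<close>)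
  have T0: "torus_sum m p k h0 = 0"
    unfolding T e signed_sum_cmult using signed_gauss_sum_vanishes[of m p k] assms by simp
  have dT: "((\<lambda>h. torus_sum m p k h) has_field_derivative signed_sum m p k (\<lambda>x. q x * exp (h0 * q x))) (at h0)"
    unfolding T signed_sum_def by (auto intro!: derivative_eq_intros simp: mult_ac)
  have "signed_sum m p k (\<lambda>x. q x * exp (h0 * q x)) =
     signed_sum m p k (\<lambda>x. exp (- h0 * c) / (4 * of_nat m * of_nat p) * (of_int x ^ 2 * cis (pi * of_int x ^ 2 / (2 * real m * real p * real k)))
        + (- c) * exp (h0 * q x))"
    unfolding e by (simp add: q_def algebra_simps)
  also have "\<dots> = exp (- h0 * c) / (4 * of_nat m * of_nat p) * X"
    unfolding signed_sum_add signed_sum_cmult X_def using T0 unfolding T by simp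
  finally have dT': "((\<lambda>h. torus_sum m p k h) has_field_derivative exp (- h0 * c) / (4 * of_nat m * of_nat p) * X) (at h0)"
    using dT by simp
  have khalf: "of_nat k * h0 / 2 = of_real pi * \<i>" using k by (simp add: h0_def)
  have s0: "sinh (of_nat k * h0 / 2) = 0"
    unfolding khalf by (simp add: sinh_field_def exp_minus) 
  have c0: "cosh (of_nat k * h0 / 2) = -1"
    unfolding khalf by (simp add: cosh_field_def exp_minus)
  have ds: "((\<lambda>h. 2 * sinh (of_nat k * h / 2)) has_field_derivative - of_nat k) (at h0)"
    using c0 by (auto intro!: derivative_eq_intros)
  have lim: "((\<lambda>h. torus_sum m p k h / (2 * sinh (of_nat k * h / 2))) \<longlongrightarrow>
       exp (- h0 * c) / (4 * of_nat m * of_nat p) * X / (- of_nat k)) (at h0)"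
    by (rule lhopital_complex_simple[OF dT' ds T0]) (use s0 k in auto)
  have "((\<lambda>h. (2 * sinh (of_nat k * h / 2)) / (h - h0)) \<longlongrightarrow> - of_nat k) (at h0)"
    by (rule lhopital_complex_simple[OF ds]) (use s0 in \<open>auto intro!: derivative_eq_intros\<close>)
  from tendsto_imp_eventually_ne[OF this, of 0]
  have ev1: "\<forall>\<^sub>F h in at h0. sinh (of_nat k * h / 2) \<noteq> 0"
    using k by (auto elim!: eventually_mono)
  have "sinh (h0 / 2) \<noteq> 0"
  proof
    assume "sinh (h0 / 2) = 0"
    hence "exp (h0 / 2) = exp (- (h0 / 2))" by (simp add: sinh_field_def)
    hence "exp (h0 / 2) * exp (h0 / 2) = 1" by (metis exp_minus_inverse)
    hence "exp h0 = 1" by (simp flip: exp_add)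
    hence "cis (2 * pi / real k) = 1" by (simp add: h0_def cis_conv_exp mult_ac)
    moreover have "cis (2 * pi / real k) \<noteq> 1"
    \<comment> \<open>For \<open>k = 2\<close> the sine vanishes as well, and the cosine decides.\<close>
    proof (cases "k = 2")
      case False
      hence "k > 2" using assms by simp
      hence "0 < sin (2 * pi / real k)" by (intro sin_gt_zero) (auto simp: field_simps)
      thus ?thesis by (auto simp: complex_eq_iff)
    qed (simp add: complex_eq_iff)
    ultimately show False by simp
  qed
  moreover have "((\<lambda>h. sinh (h / 2)) \<longlongrightarrow> sinh (h0 / 2)) (at h0)" by (intro tendsto_intros) auto
  ultimately have ev2: "\<forall>\<^sub>F h in at h0. sinh (h / 2) \<noteq> 0" using tendsto_imp_eventually_ne by blast
  have ev: "\<forall>\<^sub>F h in at h0. J_torus m p k h / J_unknot k h = torus_sum m p k h / (2 * sinh (of_nat k * h / 2))"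
    using ev1 ev2 by eventually_elim (simp add: J_torus_def J_unknot_def)
  have "((\<lambda>h. J_torus m p k h / J_unknot k h) \<longlongrightarrow>
       exp (- h0 * c) / (4 * of_nat m * of_nat p) * X / (- of_nat k)) (at h0)"
    using lim by (simp only: tendsto_cong[OF ev])
  hence "hyp_spec m p k = exp (- h0 * c) / (4 * of_nat m * of_nat p) * X / (- of_nat k)"
    unfolding hyp_spec_def h0_def[symmetric] by (intro tendsto_Lim) auto
  moreover have "exp (\<i> * of_real pi / (2 * of_nat k) * (of_nat m / of_nat p + of_nat p / of_nat m)) = exp (h0 * c)"
    by (rule arg_cong[of _ _ exp]) (simp add: h0_def c_def)
  ultimately show ?thesis unfolding X_def[symmetric] by (simp add: exp_minus field_simps)
qed


section \<open>Gaussian integrals\<close>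

lemma gaussian_moment_even:
  fixes K :: real
  assumes "K > 0"
  shows "has_bochner_integral lborel (\<lambda>t::real. exp (-K * t\<^sup>2) * t ^ (2 * n))
           (sqrt (pi / K) * fact (2 * n) / (fact n * (4 * K) ^ n))"
proof -
  define \<sigma> where "\<sigma> = sqrt (1 / (2 * K))"
  have \<sigma>: "\<sigma> > 0" "\<sigma>\<^sup>2 = 1 / (2 * K)" using assms by (auto simp: \<sigma>_def)
  have d: "sqrt (pi / K) * normal_density 0 \<sigma> t = exp (-K * t\<^sup>2)" for t
    using assms unfolding normal_density_def \<sigma>(2) by (simp add: real_sqrt_divide field_simps)
  have "has_bochner_integral lborel
    (\<lambda>t. sqrt (pi / K) * (normal_density 0 \<sigma> t * (t - 0) ^ (2 * n)))
    (sqrt (pi / K) * (fact (2 * n) / ((2 / \<sigma>\<^sup>2) ^ n * fact n)))"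
    using normal_moment_even[OF \<sigma>(1), of 0 n] by (intro has_bochner_integral_mult_right) auto
  thus ?thesis unfolding mult.assoc[symmetric] d \<sigma>(2) by (simp add: mult_ac)
qed

lemma gaussian_moment_odd:
  fixes K :: real
  assumes "K > 0"
  shows "has_bochner_integral lborel (\<lambda>t::real. exp (-K * t\<^sup>2) * t ^ (2 * n + 1)) 0"
proof -
  define \<sigma> where "\<sigma> = sqrt (1 / (2 * K))"
  have \<sigma>: "\<sigma> > 0" "\<sigma>\<^sup>2 = 1 / (2 * K)" using assms by (auto simp: \<sigma>_def)
  have d: "sqrt (pi / K) * normal_density 0 \<sigma> t = exp (-K * t\<^sup>2)" for t
    using assms unfolding normal_density_def \<sigma>(2) by (simp add: real_sqrt_divide field_simps)
  have "has_bochner_integral lborel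
    (\<lambda>t. sqrt (pi / K) * (normal_density 0 \<sigma> t * (t - 0) ^ (2 * n + 1))) (sqrt (pi / K) * 0)"
    using normal_moment_odd[OF \<sigma>(1), of 0 n] by (intro has_bochner_integral_mult_right) auto
  thus ?thesis unfolding mult.assoc[symmetric] d by simp
qed

text \<open>Completing the square; half of the Gaussian decay is kept.\<close>

lemma gaussian_absorbs_exponential:
  fixes K c t :: real
  assumes "K > 0"
  shows "exp (-K * t\<^sup>2) * exp (c * \<bar>t\<bar>) \<le> exp (c\<^sup>2 / (2 * K)) * exp (- (K / 2) * t\<^sup>2)"
proof -
  have "0 \<le> (K / 2) * (\<bar>t\<bar> - c / K)\<^sup>2" using assms by simp
  also have "\<dots> = c\<^sup>2 / (2 * K) - c * \<bar>t\<bar> + (K / 2) * t\<^sup>2"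
    using assms by (simp add: power2_eq_square field_simps)
  finally show ?thesis by (simp flip: exp_add)
qed

text \<open>This is the source of all integrability claims and of the remainder bound: exponential growth costs only a factor that stays bounded for large \<open>K\<close>, so the decay \<open>K^(-j-1/2)\<close> of the Gaussian moment persists.\<close>

lemma gaussian_integral_exponential_growth:
  fixes f :: "real \<Rightarrow> complex" and K c C :: real
  assumes "K > 0" "f \<in> borel_measurable borel"
    and "\<And>t. norm (f t) \<le> C * t ^ (2 * j) * exp (c * \<bar>t\<bar>)"
  shows "integrable lborel (\<lambda>t. exp (-K * t\<^sup>2) *\<^sub>R f t)" (is ?A)
    and "norm (\<integral>t. exp (-K * t\<^sup>2) *\<^sub>R f t \<partial>lborel) \<le>
           C * exp (c\<^sup>2 / (2 * K)) * (sqrt (2 * pi / K) * fact (2 * j) / (fact j * (2 * K) ^ j))" (is ?B)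
proof -
  define D where "D = C * exp (c\<^sup>2 / (2 * K))"
  have K2: "K / 2 > 0" using assms by simp
  have C: "C \<ge> 0"
    using order_trans[OF norm_ge_zero assms(3)[of 1]] by (simp add: zero_le_mult_iff)
  have hb: "has_bochner_integral lborel (\<lambda>t::real. D * (exp (-(K/2) * t\<^sup>2) * t ^ (2 * j)))
      (D * (sqrt (pi / (K/2)) * fact (2 * j) / (fact j * (4 * (K/2)) ^ j)))"
    using gaussian_moment_even[OF K2, of j] by (intro has_bochner_integral_mult_right) auto
  have le: "norm (exp (-K * t\<^sup>2) *\<^sub>R f t) \<le> D * (exp (-(K/2) * t\<^sup>2) * t ^ (2 * j))" for t
  proof -
    have "norm (exp (-K * t\<^sup>2) *\<^sub>R f t) \<le> exp (-K * t\<^sup>2) * (C * t ^ (2 * j) * exp (c * \<bar>t\<bar>))"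
      using assms(3)[of t] by simp
    also have "\<dots> = (C * t ^ (2 * j)) * (exp (-K * t\<^sup>2) * exp (c * \<bar>t\<bar>))" by simp
    also have "\<dots> \<le> (C * t ^ (2 * j)) * (exp (c\<^sup>2 / (2 * K)) * exp (- (K / 2) * t\<^sup>2))"
      using C by (intro mult_left_mono gaussian_absorbs_exponential[OF assms(1)]) auto
    finally show ?thesis by (simp add: D_def mult_ac)
  qed
  show int: ?A
  proof (rule Bochner_Integration.integrable_bound[OF integrable.intros[OF hb]])
    show "(\<lambda>t. exp (-K * t\<^sup>2) *\<^sub>R f t) \<in> borel_measurable lborel"
      using assms(2) by measurable
    show "AE t in lborel. norm (exp (-K * t\<^sup>2) *\<^sub>R f t) \<le> norm (D * (exp (-(K/2) * t\<^sup>2) * t ^ (2 * j)))"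
      by (rule AE_I2) (use le abs_ge_self order_trans in \<open>fastforce\<close>)
  qed
  have "norm (\<integral>t. exp (-K * t\<^sup>2) *\<^sub>R f t \<partial>lborel) \<le> (\<integral>t. D * (exp (-(K/2) * t\<^sup>2) * t ^ (2 * j)) \<partial>lborel)"
    by (rule Bochner_Integration.integral_norm_bound_integral[OF int integrable.intros[OF hb]]) (use le in auto)
  also have "\<dots> = D * (sqrt (pi / (K/2)) * fact (2 * j) / (fact j * (4 * (K/2)) ^ j))"
    using hb by (rule has_bochner_integral_integral_eq)
  finally show ?B by (simp add: D_def mult_ac)
qed

text \<open>The exponent \<open>b\<close> is a complex number, so a real shift of the variable is not available. Instead the exponential series is integrated term by term; only even moments contribute and they resum to exponential series in \<open>y = b^2 / (4 K)\<close>.\<close>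

lemma gaussian_second_moment_exp:
  fixes K :: real and b :: complex
  assumes "K > 0"
  shows "integrable lborel (\<lambda>t. exp (-K * t\<^sup>2) *\<^sub>R (of_real t ^ 2 * exp (b * of_real t)))" (is ?A)
    and "(\<integral>t. exp (-K * t\<^sup>2) *\<^sub>R (of_real t ^ 2 * exp (b * of_real t)) \<partial>lborel) =
       of_real (sqrt (pi / K) / (2 * K)) * (1 + 2 * (b\<^sup>2 / (4 * of_real K))) * exp (b\<^sup>2 / (4 * of_real K))" (is ?B)
proof -
  define f where "f t = exp (-K * t\<^sup>2) *\<^sub>R (of_real t ^ 2 * exp (b * of_real t))" for t
  \<comment> \<open>Partial sums of even length, so that odd and even terms can be paired off.\<close>
  define s where "s M t = exp (-K * t\<^sup>2) *\<^sub>R (of_real t ^ 2 * (\<Sum>n<2*M. (b * of_real t) ^ n / fact n))" for M t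
  define w where "w t = exp (-K * t\<^sup>2) *\<^sub>R (complex_of_real (1 * t ^ (2*1) * exp (norm b * \<bar>t\<bar>)))" for t
  have "norm (of_real t ^ 2 * exp (b * of_real t)) \<le> 1 * t ^ (2 * 1) * exp (norm b * \<bar>t\<bar>)" for t
  proof -
    have "norm (exp (b * of_real t)) \<le> exp (norm b * \<bar>t\<bar>)"
      using norm_exp[of "b * of_real t"] by (simp only: norm_mult norm_of_real)
    thus ?thesis by (simp only: norm_mult norm_power norm_of_real) (simp add: mult_left_mono)
  qed
  thus int: ?A
    by (intro gaussian_integral_exponential_growth(1)[where C = 1 and j = 1 and c = "norm b"] assms) auto
  have w: "integrable lborel (\<lambda>t. norm (w t))" unfolding w_def
    by (intro integrable_norm gaussian_integral_exponential_growth(1)[where C = 1 and j = 1 and c = "norm b"])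
       (use assms in \<open>auto simp: norm_mult norm_power\<close>)
  have lim1: "(\<lambda>M. integral\<^sup>L lborel (s M)) \<longlonglongrightarrow> integral\<^sup>L lborel f"
  proof (rule integral_dominated_convergence[OF _ _ w])
    show "f \<in> borel_measurable lborel" unfolding f_def by measurable
    show "s M \<in> borel_measurable lborel" for M unfolding s_def by measurable
    show "AE t in lborel. (\<lambda>M. s M t) \<longlonglongrightarrow> f t"
    proof (rule AE_I2)
      fix t
      have "(\<lambda>n. (b * of_real t) ^ n / fact n) sums exp (b * of_real t)"
        using exp_converges[of "b * of_real t"] by (simp add: scaleR_conv_of_real field_simps)
      hence "(\<lambda>M. \<Sum>n<M. (b * of_real t) ^ n / fact n) \<longlonglongrightarrow> exp (b * of_real t)"
        by (simp add: sums_def)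
      moreover have "filterlim (\<lambda>M::nat. 2 * M) at_top sequentially"
        by (rule filterlim_subseq) (auto simp: strict_mono_def)
      ultimately have "(\<lambda>M. \<Sum>n<2*M. (b * of_real t) ^ n / fact n) \<longlonglongrightarrow> exp (b * of_real t)"
        by (rule filterlim_compose)
      thus "(\<lambda>M. s M t) \<longlonglongrightarrow> f t" unfolding s_def f_def by (intro tendsto_intros)
    qed
    show "AE t in lborel. norm (s M t) \<le> norm (w t)" for M
    proof (rule AE_I2)
      fix t
      have "norm (\<Sum>n<2*M. (b * of_real t) ^ n / fact n) \<le> (\<Sum>n<2*M. (norm b * \<bar>t\<bar>) ^ n / fact n)"
        by (rule sum_norm_le) (simp add: norm_divide norm_power norm_mult)
      also have "\<dots> \<le> exp (norm b * \<bar>t\<bar>)"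
      proof -
        have "(\<lambda>n. (norm b * \<bar>t\<bar>) ^ n / fact n) sums exp (norm b * \<bar>t\<bar>)"
          using exp_converges[of "norm b * \<bar>t\<bar>"] by (simp add: field_simps)
        thus ?thesis by (metis (no_types, lifting) finite_lessThan sums_unique sums_summable
             sum_le_suminf divide_nonneg_pos fact_gt_zero zero_le_power mult_nonneg_nonneg norm_ge_zero abs_ge_zero)
      qed
      finally show "norm (s M t) \<le> norm (w t)"
        unfolding s_def w_def by (auto simp: norm_mult norm_power intro!: mult_left_mono)
    qed
  qed
  define y where "y = b\<^sup>2 / (4 * of_real K)"
  define q where "q = complex_of_real (sqrt (pi / K) / (2 * K))"
  have mom: "has_bochner_integral lborel
       (\<lambda>t. exp (-K * t\<^sup>2) *\<^sub>R (of_real t ^ 2 * ((b * of_real t) ^ n / fact n)))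
       (if even n then q * ((1 + 2 * of_nat (n div 2)) * (y ^ (n div 2) / fact (n div 2))) else 0)" for n
  proof (cases "even n")
    case True
    then obtain j where n: "n = 2 * j" by (auto elim: evenE)
    have "has_bochner_integral lborel
       (\<lambda>t. b ^ n / fact n * of_real (exp (-K * t\<^sup>2) * t ^ (2 * (Suc j))))
       (b ^ n / fact n * of_real (sqrt (pi / K) * fact (2 * Suc j) / (fact (Suc j) * (4 * K) ^ Suc j)))"
      using gaussian_moment_even[OF assms, of "Suc j"]
      by (intro has_bochner_integral_mult_right has_bochner_integral_of_real) auto
    moreover have "b ^ n / fact n * of_real (exp (-K * t\<^sup>2) * t ^ (2 * (Suc j))) =
        exp (-K * t\<^sup>2) *\<^sub>R (of_real t ^ 2 * ((b * of_real t) ^ n / fact n))" for t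
      unfolding n by (simp add: scaleR_conv_of_real power_mult_distrib power_add[symmetric] field_simps
            power2_eq_square)
    moreover have "b ^ n / fact n * of_real (sqrt (pi / K) * fact (2 * Suc j) / (fact (Suc j) * (4 * K) ^ Suc j))
        = q * ((1 + 2 * of_nat j) * (y ^ j / fact j))"
    proof -
      have "fact (2 * Suc j) = (2 * (of_nat j + 1)) * (1 + 2 * of_nat j) * (fact (2 * j) :: complex)"
        by (simp add: algebra_simps)
      moreover have "fact (Suc j) = (of_nat j + 1) * (fact j :: complex)" by simp
      moreover have "of_nat j + 1 \<noteq> (0::complex)"
        by (metis of_nat_Suc of_nat_neq_0 add.commute)
      moreover from this have "of_nat j * 4 + 4 \<noteq> (0::complex)"
        by (metis distrib_right mult_1 mult_eq_0_iff zero_neq_numeral)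
      ultimately show ?thesis
        unfolding n q_def y_def using assms
        by (simp add: power_divide power_mult power_mult_distrib divide_simps del: fact_Suc)
           (simp add: algebra_simps)
    qed
    ultimately show ?thesis using True by (simp add: n)
  next
    case False
    then obtain j where n: "n = 2 * j + 1" by (auto elim: oddE)
    have "has_bochner_integral lborel
       (\<lambda>t. b ^ n / fact n * of_real (exp (-K * t\<^sup>2) * t ^ (2 * (Suc j) + 1)))
       (b ^ n / fact n * of_real 0)"
      using gaussian_moment_odd[OF assms, of "Suc j"]
      by (intro has_bochner_integral_mult_right has_bochner_integral_of_real) auto
    moreover have "b ^ n / fact n * of_real (exp (-K * t\<^sup>2) * t ^ (2 * (Suc j) + 1)) =
        exp (-K * t\<^sup>2) *\<^sub>R (of_real t ^ 2 * ((b * of_real t) ^ n / fact n))" for t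
      unfolding n by (simp add: scaleR_conv_of_real power_mult_distrib power_add[symmetric] field_simps
            power2_eq_square)
    ultimately show ?thesis using False by simp
  qed
  have ev: "(\<Sum>n<2*M. if even n then g (n div 2) else (0::complex)) = (\<Sum>j<M. g j)" for M :: nat and g
    by (induction M) auto
  have val: "integral\<^sup>L lborel (s M) = (\<Sum>j<M. q * ((1 + 2 * of_nat j) * (y ^ j / fact j)))" for M
  proof -
    have "has_bochner_integral lborel
       (\<lambda>t. \<Sum>n<2*M. exp (-K * t\<^sup>2) *\<^sub>R (of_real t ^ 2 * ((b * of_real t) ^ n / fact n)))
       (\<Sum>n<2*M. if even n then q * ((1 + 2 * of_nat (n div 2)) * (y ^ (n div 2) / fact (n div 2))) else 0)"
      by (intro has_bochner_integral_sum mom)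
    thus ?thesis unfolding ev[where g = "\<lambda>j. q * ((1 + 2 * of_nat j) * (y ^ j / fact j))"]
      by (intro has_bochner_integral_integral_eq)
         (simp add: s_def[abs_def] sum_distrib_left scaleR_right.sum)
  qed
  have "(\<lambda>j. q * ((1 + 2 * of_nat j) * (y ^ j / fact j))) sums (q * (exp y + 2 * (y * exp y)))"
  proof -
    have 1: "(\<lambda>j. y ^ j / fact j) sums exp y"
      using exp_converges[of y] by (simp add: scaleR_conv_of_real field_simps)
    have "(\<lambda>j. of_nat (Suc j) * (y ^ Suc j / fact (Suc j))) sums (y * exp y)"
    proof -
      have "of_nat (Suc j) * (y ^ Suc j / fact (Suc j)) = y * (y ^ j / fact j)" for j
        by (simp add: divide_simps del: of_nat_Suc)
      thus ?thesis using sums_mult[OF 1, of y] by simp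
    qed
    hence "(\<lambda>j. of_nat j * (y ^ j / fact j)) sums (y * exp y)"
      by (subst (asm) sums_Suc_iff) simp
    hence "(\<lambda>j. y ^ j / fact j + 2 * (of_nat j * (y ^ j / fact j))) sums (exp y + 2 * (y * exp y))"
      by (intro sums_add sums_mult 1)
    hence "(\<lambda>j. q * (y ^ j / fact j + 2 * (of_nat j * (y ^ j / fact j)))) sums (q * (exp y + 2 * (y * exp y)))"
      by (rule sums_mult)
    thus ?thesis by (simp add: algebra_simps)
  qed
  hence "(\<lambda>M. integral\<^sup>L lborel (s M)) \<longlonglongrightarrow> q * (exp y + 2 * (y * exp y))"
    unfolding val sums_def .
  hence "integral\<^sup>L lborel f = q * (exp y + 2 * (y * exp y))"
    using LIMSEQ_unique lim1 by blast
  thus ?B by (simp add: f_def[abs_def] q_def y_def algebra_simps)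
qed


section \<open>The function \<open>\<tau>\<close> as a quotient of hyperbolic sines\<close>

text \<open>The quotient itself, with division by zero giving \<open>0\<close>. For coprime \<open>m\<close> and \<open>p\<close> this is also the limit at \<open>0\<close> and \<open>pi \<i>\<close>, so there the function is already holomorphic. At the removable singularities between them it may have the wrong value, which is harmless: they are among the isolated points counted as possible poles, and get residue \<open>0\<close>.\<close>

definition tau_quotient :: "nat \<Rightarrow> nat \<Rightarrow> complex \<Rightarrow> complex" where
  "tau_quotient m p z = 2 * sinh (of_nat m * z) * sinh (of_nat p * z) / sinh (of_nat m * of_nat p * z)"

lemma sinh_eq_0_iff_complex: "sinh (z::complex) = 0 \<longleftrightarrow> (\<exists>n::int. z = of_int n * (of_real pi * \<i>))"
proof -
  have "sinh z = 0 \<longleftrightarrow> exp z = exp (-z)" by (simp add: sinh_field_def)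
  also have "\<dots> \<longleftrightarrow> exp (2 * z) = 1"
  proof -
    have "exp (2 * z) = exp z * exp z" by (simp flip: exp_add)
    moreover have "exp (-z) * exp z = 1" by (simp flip: exp_add)
    ultimately show ?thesis by (metis exp_not_eq_zero mult_right_cancel)
  qed
  also have "\<dots> \<longleftrightarrow> (\<exists>n::int. z = of_int n * (of_real pi * \<i>))"
    unfolding exp_eq_1 by (auto simp: complex_eq_iff)
  finally show ?thesis .
qed

lemma sinh_add_pi_multiple: "sinh (z + of_nat n * (of_real pi * \<i>)) = (-1) ^ n * sinh (z::complex)"
proof (induction n)
  case (Suc n)
  have step: "sinh (w + of_real pi * \<i>) = - sinh (w::complex)" for w
    by (simp add: sinh_field_def exp_add exp_diff field_simps)
  have eq: "z + of_nat (Suc n) * (of_real pi * \<i>) = (z + of_nat n * (of_real pi * \<i>)) + of_real pi * \<i>"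
    by (simp add: algebra_simps)
  show ?case unfolding eq step Suc by simp
qed simp

lemma norm_sinh_le: "norm (sinh (z::complex)) \<le> exp \<bar>Re z\<bar>"
proof -
  have "norm (sinh z) = norm (exp z - exp (-z)) / 2" by (simp add: sinh_field_def norm_divide)
  also have "\<dots> \<le> (norm (exp z) + norm (exp (-z))) / 2" by (intro divide_right_mono norm_triangle_ineq4) auto
  also have "\<dots> \<le> exp \<bar>Re z\<bar>" by (simp add: abs_if)
  finally show ?thesis .
qed

lemma norm_sinh_ge: "\<bar>Re z\<bar> \<le> norm (sinh (z::complex))"
proof -
  have *: "x \<le> (exp x - exp (-x)) / 2" if "x \<ge> 0" for x :: real
    using real_le_x_sinh[OF that] by (simp add: exp_minus)
  have "\<bar>Re z\<bar> \<le> (exp \<bar>Re z\<bar> - exp (- \<bar>Re z\<bar>)) / 2" by (rule *) simp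
  also have "\<dots> = \<bar>norm (exp z) - norm (exp (-z))\<bar> / 2" by (cases "Re z \<ge> 0") auto
  also have "\<dots> \<le> norm (exp z - exp (-z)) / 2" by (intro divide_right_mono norm_triangle_ineq3) auto
  also have "\<dots> = norm (sinh z)" by (simp add: sinh_field_def norm_divide)
  finally show ?thesis .
qed

lemma tau_quotient_0 [simp]: "tau_quotient m p 0 = 0"
  by (simp add: tau_quotient_def)

lemma tau_quotient_minus [simp]: "tau_quotient m p (- z) = - tau_quotient m p z"
  by (simp add: tau_quotient_def)

text \<open>The sign is \<open>(-1)^(m + p - m p)\<close>, and the exponent equals \<open>1 - (m - 1) (p - 1)\<close>, which is odd because coprime numbers are not both even.\<close>

lemma tau_quotient_add_pi:
  assumes "coprime m p"
  shows "tau_quotient m p (z + of_real pi * \<i>) = - tau_quotient m p z"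
proof -
  have s: "sinh (of_nat n * (z + of_real pi * \<i>)) = (-1) ^ n * sinh (of_nat n * z)" for n
    using sinh_add_pi_multiple[of "of_nat n * z" n] by (simp add: algebra_simps)
  have odd: "odd (m + p + m * p)"
  proof (rule ccontr)
    assume "\<not> odd (m + p + m * p)"
    hence "even m \<and> even p" by auto
    thus False using coprime_common_divisor[OF assms, of 2] by auto
  qed
  have "tau_quotient m p (z + of_real pi * \<i>) = ((-1) ^ m * (-1) ^ p / (-1) ^ (m * p)) * tau_quotient m p z"
    unfolding tau_quotient_def using s[of m] s[of p] s[of "m * p"] by simp
  also have "(-1) ^ m * (-1) ^ p / (-1) ^ (m * p) = (-1 :: complex) ^ (m + p + m * p)"
    by (cases "even (m * p)") (auto simp: power_add)
  also have "\<dots> = -1" using odd by (rule neg_one_odd_power)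
  finally show ?thesis by simp
qed

text \<open>The numerator has a double zero at \<open>0\<close> and the denominator a simple one.\<close>

lemma tau_quotient_tendsto_0:
  assumes "m > 0" "p > 0"
  shows "(tau_quotient m p \<longlongrightarrow> 0) (at 0)"
  unfolding tau_quotient_def[abs_def]
proof (rule lhopital_complex_simple)
  show "((\<lambda>z. 2 * sinh (of_nat m * z) * sinh (of_nat p * z)) has_field_derivative 0) (at 0)"
    by (auto intro!: derivative_eq_intros)
  show "((\<lambda>z::complex. sinh (of_nat m * of_nat p * z)) has_field_derivative of_nat m * of_nat p) (at 0)"
    by (auto intro!: derivative_eq_intros)
qed (use assms in auto)

lemma tau_quotient_tendsto_at_pi:
  assumes "m > 0" "p > 0" "coprime m p"
  shows "(tau_quotient m p \<longlongrightarrow> 0) (at (of_real pi * \<i>))"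
proof -
  have "((\<lambda>z. - tau_quotient m p z) \<longlongrightarrow> - 0) (at 0)"
    by (intro tendsto_minus tau_quotient_tendsto_0 assms)
  hence "((\<lambda>z. tau_quotient m p (z + of_real pi * \<i>)) \<longlongrightarrow> 0) (at 0)"
    by (simp add: tau_quotient_add_pi[OF assms(3)])
  thus ?thesis by (subst filterlim_at_to_0) (simp add: add.commute)
qed

definition tau_pole :: "nat \<Rightarrow> nat \<Rightarrow> nat \<Rightarrow> complex" where
  "tau_pole m p j = of_nat j / (of_nat m * of_nat p) * (of_real pi * \<i>)"

lemma tau_quotient_holomorphic:
  assumes "m > 0" "p > 0" "coprime m p" "open S"
    and "\<And>n::int. n \<noteq> 0 \<Longrightarrow> n \<noteq> int (m * p) \<Longrightarrow> of_int n / (of_nat m * of_nat p) * (of_real pi * \<i>) \<notin> S"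
  shows "tau_quotient m p holomorphic_on S"
proof (rule no_isolated_singularity)
  let ?K = "{0, of_real pi * \<i>}"
  have mp: "of_nat m * of_nat p \<noteq> (0::complex)" using assms by simp
  have ne: "sinh (of_nat m * of_nat p * z) \<noteq> 0" if "z \<in> S - ?K" for z
  proof
    assume "sinh (of_nat m * of_nat p * z) = 0"
    then obtain n :: int where n: "of_nat m * of_nat p * z = of_int n * (of_real pi * \<i>)"
      by (auto simp: sinh_eq_0_iff_complex)
    hence z: "z = of_int n / (of_nat m * of_nat p) * (of_real pi * \<i>)"
      using mp by (simp add: field_simps)
    have "n \<noteq> 0" "n \<noteq> int (m * p)" using that z mp by auto
    from assms(5)[OF this] show False using that z by simp
  qed
  show hol: "tau_quotient m p holomorphic_on S - ?K"
    unfolding tau_quotient_def[abs_def] sinh_field_def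
    by (intro holomorphic_intros) (use ne[unfolded sinh_field_def] in auto)
  show "continuous_on S (tau_quotient m p)"
  proof (rule continuous_at_imp_continuous_on, rule ballI)
    fix z assume z: "z \<in> S"
    have o: "open (S - ?K)" using assms by (intro open_Diff) auto
    consider "z = 0" | "z = of_real pi * \<i>" | "z \<in> S - ?K" using z by blast
    thus "isCont (tau_quotient m p) z"
    proof cases
      case 1 thus ?thesis using tau_quotient_tendsto_0[OF assms(1,2)] by (simp add: isCont_def)
    next
      case 2 thus ?thesis using tau_quotient_tendsto_at_pi[OF assms(1-3)]
          tau_quotient_add_pi[OF assms(3), of 0] by (simp add: isCont_def)
    next
      case 3 thus ?thesis
        using holomorphic_on_imp_continuous_on[OF hol] o by (simp add: continuous_on_eq_continuous_at)
    qed
  qed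
qed (use assms in auto)

lemma tau_quotient_holomorphic_near_0:
  assumes "m > 0" "p > 0" "coprime m p"
  shows "tau_quotient m p holomorphic_on ball 0 (pi / (real m * real p))"
proof (rule tau_quotient_holomorphic[OF assms])
  fix n :: int assume "n \<noteq> 0"
  hence "\<bar>real_of_int n\<bar> \<ge> 1" by linarith
  hence "norm (of_int n / (of_nat m * of_nat p) * (of_real pi * \<i>)) \<ge> pi / (real m * real p)"
    using assms by (simp add: norm_mult norm_divide divide_simps)
  thus "of_int n / (of_nat m * of_nat p) * (of_real pi * \<i>) \<notin> ball 0 (pi / (real m * real p))" by simp
qed auto

lemma torus_tau_eventually:
  assumes "m > 0" "p > 0" "coprime m p"
  shows "\<forall>\<^sub>F z in nhds 0. torus_tau m p z = tau_quotient m p z"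
proof -
  let ?B = "ball (0::complex) (pi / (real m * real p))"
  have eq: "torus_tau m p = remove_sings (tau_quotient m p)"
    by (simp add: torus_tau_def tau_quotient_def[abs_def])
  have "torus_tau m p z = tau_quotient m p z" if "z \<in> ?B" for z
  proof -
    have "tau_quotient m p analytic_on {z}"
      using tau_quotient_holomorphic_near_0[OF assms] that
      by (meson analytic_at open_ball)
    thus ?thesis unfolding eq by simp
  qed
  moreover have "\<forall>\<^sub>F z in nhds 0. z \<in> ?B" using assms by (intro eventually_nhds_in_open) auto
  ultimately show ?thesis by (rule eventually_mono[rotated])
qed

text \<open>A quotient of exponentials, once the denominator is kept away from its zeros, all of which lie on the imaginary axis.\<close>

lemma tau_quotient_bound:
  assumes "m > 0" "p > 0" "\<bar>Re z\<bar> \<ge> d" "d > 0"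
  shows "norm (tau_quotient m p z) \<le> 2 / (real m * real p * d) * exp ((real m + real p) * \<bar>Re z\<bar>)"
proof -
  have "norm (sinh (of_nat m * z)) * norm (sinh (of_nat p * z)) \<le> exp (real m * \<bar>Re z\<bar>) * exp (real p * \<bar>Re z\<bar>)"
    using norm_sinh_le[of "of_nat m * z"] norm_sinh_le[of "of_nat p * z"]
    by (intro mult_mono) (auto simp: abs_mult)
  also have "\<dots> = exp ((real m + real p) * \<bar>Re z\<bar>)" by (simp flip: exp_add add: algebra_simps)
  finally have 1: "norm (sinh (of_nat m * z)) * norm (sinh (of_nat p * z)) \<le> exp ((real m + real p) * \<bar>Re z\<bar>)" .
  have "real m * real p * d \<le> real m * real p * \<bar>Re z\<bar>" using assms by simp
  also have "\<dots> \<le> norm (sinh (of_nat m * of_nat p * z))"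
    using norm_sinh_ge[of "of_nat m * of_nat p * z"] by (simp add: abs_mult)
  finally have 2: "real m * real p * d \<le> norm (sinh (of_nat m * of_nat p * z))" .
  have "norm (tau_quotient m p z) = 2 * (norm (sinh (of_nat m * z)) * norm (sinh (of_nat p * z))) / norm (sinh (of_nat m * of_nat p * z))"
    by (simp add: tau_quotient_def norm_divide norm_mult)
  also have "\<dots> \<le> 2 * exp ((real m + real p) * \<bar>Re z\<bar>) / (real m * real p * d)"
    by (rule frac_le) (use 1 2 assms in auto)
  finally show ?thesis by simp
qed

text \<open>The direction in which \<open>exp (\<i> K w^2)\<close> becomes the real Gaussian \<open>exp (- K t^2)\<close>.\<close>

definition \<omega> :: complex where "\<omega> = cis (pi / 4)"

lemma \<omega>_facts: "Re \<omega> = sqrt 2 / 2" "Im \<omega> = sqrt 2 / 2" "norm \<omega> = 1" "\<omega> ^ 2 = \<i>" "\<omega> \<noteq> 0"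
proof -
  show "Re \<omega> = sqrt 2 / 2" "Im \<omega> = sqrt 2 / 2" "norm \<omega> = 1" "\<omega> \<noteq> 0"
    by (simp_all add: \<omega>_def cos_45 sin_45)
  have "\<omega> ^ 2 = cis (pi / 2)" unfolding \<omega>_def by (simp add: power2_eq_square cis_mult)
  thus "\<omega> ^ 2 = \<i>" by simp
qed

lemma tau_quotient_measurable [measurable]:
  "(\<lambda>t. tau_quotient m p (\<omega> * of_real t)) \<in> borel_measurable borel"
  unfolding tau_quotient_def
  by (intro borel_measurable_divide borel_measurable_continuous_onI continuous_intros)

lemma tau_quotient_bound_line:
  assumes "m > 0" "p > 0" "coprime m p"
  obtains C where "\<And>t. norm (tau_quotient m p (\<omega> * of_real t)) \<le> C * exp ((real m + real p) * \<bar>t\<bar>)"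
proof -
  define d where "d = pi / (2 * real m * real p)"
  have d: "d > 0" "d < pi / (real m * real p)" using assms by (simp_all add: d_def field_simps)
  have "continuous_on (cball 0 d) (tau_quotient m p)"
    by (rule continuous_on_subset[OF holomorphic_on_imp_continuous_on[OF tau_quotient_holomorphic_near_0[OF assms]]])
       (use d in \<open>simp add: cball_subset_ball_iff\<close>)
  hence "bounded (tau_quotient m p ` cball 0 d)"
    by (intro compact_imp_bounded compact_continuous_image) auto
  then obtain B where "B > 0" "\<forall>x\<in>tau_quotient m p ` cball 0 d. norm x \<le> B"
    unfolding bounded_pos by blast
  hence B: "\<And>z. z \<in> cball 0 d \<Longrightarrow> norm (tau_quotient m p z) \<le> B" "B > 0" by blast+
  define e where "e = d * (sqrt 2 / 2)"
  have e: "e > 0" using d by (simp add: e_def)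
  have "norm (tau_quotient m p (\<omega> * of_real t)) \<le> max B (2 / (real m * real p * e)) * exp ((real m + real p) * \<bar>t\<bar>)" for t
  proof (cases "\<bar>t\<bar> \<le> d")
    case True
    hence "norm (tau_quotient m p (\<omega> * of_real t)) \<le> B * 1"
      using B(1)[of "\<omega> * of_real t"] by (simp add: norm_mult \<omega>_facts)
    also have "\<dots> \<le> max B (2 / (real m * real p * e)) * exp ((real m + real p) * \<bar>t\<bar>)"
      using B by (intro mult_mono) auto
    finally show ?thesis .
  next
    case False
    have re: "\<bar>Re (\<omega> * of_real t)\<bar> = sqrt 2 / 2 * \<bar>t\<bar>" by (simp add: \<omega>_facts abs_mult)
    have "sqrt 2 / 2 \<le> (1::real)" using real_sqrt_le_mono[of 2 4] by simp
    from mult_right_mono[OF this, of "\<bar>t\<bar>"]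
    have le: "\<bar>Re (\<omega> * of_real t)\<bar> \<le> \<bar>t\<bar>" unfolding re by simp
    have "\<bar>Re (\<omega> * of_real t)\<bar> \<ge> e" unfolding re e_def using False by simp
    hence "norm (tau_quotient m p (\<omega> * of_real t)) \<le> 2 / (real m * real p * e) * exp ((real m + real p) * \<bar>Re (\<omega> * of_real t)\<bar>)"
      by (intro tau_quotient_bound assms e)
    also have "\<dots> \<le> max B (2 / (real m * real p * e)) * exp ((real m + real p) * \<bar>t\<bar>)"
      using B e le assms by (intro mult_mono) (auto intro!: mult_left_mono)
    finally show ?thesis .
  qed
  thus ?thesis by (rule that)
qed

lemma holomorphic_Taylor_bound:
  assumes "g holomorphic_on ball 0 r" "r > 0"
  obtains C s where "s > 0" "\<And>z. norm z \<le> s \<Longrightarrow>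
     norm (g z - (\<Sum>i\<le>n. (deriv ^^ i) g 0 * z ^ i / fact i)) \<le> C * norm z ^ Suc n"
proof -
  define s where "s = r / 2"
  have s: "s > 0" "cball 0 s \<subseteq> ball (0::complex) r" using assms(2) by (auto simp: s_def)
  have hd: "(deriv ^^ i) g holomorphic_on ball 0 r" for i
    by (intro holomorphic_higher_deriv assms) auto
  have "bounded ((deriv ^^ Suc n) g ` cball 0 s)"
    by (intro compact_imp_bounded compact_continuous_image
        continuous_on_subset[OF holomorphic_on_imp_continuous_on[OF hd] s(2)]) auto
  then obtain B where "\<forall>x\<in>(deriv ^^ Suc n) g ` cball 0 s. norm x \<le> B"
    unfolding bounded_iff by blast
  hence B: "norm ((deriv ^^ Suc n) g z) \<le> B" if "z \<in> cball 0 s" for z using that by blast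
  have "norm (g z - (\<Sum>i\<le>n. (deriv ^^ i) g 0 * z ^ i / fact i)) \<le> (B / fact n) * norm z ^ Suc n"
    if "norm z \<le> s" for z
  proof -
    have "norm ((deriv ^^ 0) g z - (\<Sum>i\<le>n. (deriv ^^ i) g 0 * (z - 0) ^ i / fact i)) \<le> B * norm (z - 0) ^ Suc n / fact n"
    proof (rule complex_Taylor[where S = "cball 0 s"])
      fix i x assume x: "x \<in> cball (0::complex) s"
      have "((deriv ^^ i) g has_field_derivative deriv ((deriv ^^ i) g) x) (at x)"
        using x s(2) by (intro holomorphic_derivI[OF hd open_ball]) auto
      thus "((deriv ^^ i) g has_field_derivative (deriv ^^ Suc i) g x) (at x within cball 0 s)"
        by (simp add: has_field_derivative_at_within)
    qed (use B that s in auto)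
    thus ?thesis by simp
  qed
  thus ?thesis using s that by blast
qed

text \<open>The Taylor bound near \<open>0\<close> and the growth bound away from \<open>0\<close> combine into one estimate of order \<open>2 N + 2\<close> valid on the whole line. The order is \<open>2 N + 2\<close> since the function is even, and the constant term is absent since it vanishes at \<open>0\<close>.\<close>

lemma tau_quotient_even_Taylor:
  assumes "m > 0" "p > 0" "coprime m p"
  defines "g \<equiv> (\<lambda>z. z * tau_quotient m p z)"
  obtains C c where
    "\<And>t. norm (g (\<omega> * of_real t) - (\<Sum>n=1..N. (deriv ^^ (2 * n)) g 0 / fact (2 * n) * (\<omega> * of_real t) ^ (2 * n)))
        \<le> C * t ^ (2 * Suc N) * exp (c * \<bar>t\<bar>)"
proof -
  let ?r = "pi / (real m * real p)"
  have hol: "g holomorphic_on ball 0 ?r"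
    unfolding g_def by (intro holomorphic_intros tau_quotient_holomorphic_near_0 assms)
  have r: "?r > 0" using assms by simp
  have odd0: "(deriv ^^ i) g 0 = 0" if "odd i" for i
  proof -
    have "(\<lambda>w. g (-1 * w)) = g" by (auto simp: g_def)
    moreover have "(deriv ^^ i) (\<lambda>w. g (-1 * w)) 0 = (-1) ^ i * (deriv ^^ i) g (-1 * 0)"
      by (rule higher_deriv_compose_linear[OF hol, where S = "ball 0 ?r"]) (use r in auto)
    ultimately show ?thesis using that by simp
  qed
  define P where "P z = (\<Sum>n=1..N. (deriv ^^ (2 * n)) g 0 / fact (2 * n) * z ^ (2 * n))" for z
  have P: "(\<Sum>i\<le>Suc (2 * N). (deriv ^^ i) g 0 * z ^ i / fact i) = P z" for z
  proof -
    have "(\<Sum>i\<le>Suc (2 * N). (deriv ^^ i) g 0 * z ^ i / fact i) =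
        (\<Sum>n\<le>N. (deriv ^^ (2 * n)) g 0 * z ^ (2 * n) / fact (2 * n))"
      by (induction N) (simp_all add: odd0 del: funpow.simps fact_Suc)
    also have "\<dots> = (\<Sum>n=1..N. (deriv ^^ (2 * n)) g 0 * z ^ (2 * n) / fact (2 * n))"
      by (rule sum.mono_neutral_right) (auto simp: g_def not_less_eq_eq)
    finally show ?thesis by (simp add: P_def)
  qed
  obtain C1 s where s: "s > 0" and C1: "\<And>z. norm z \<le> s \<Longrightarrow> norm (g z - P z) \<le> C1 * norm z ^ Suc (Suc (2 * N))"
    using holomorphic_Taylor_bound[OF hol r, of "Suc (2 * N)"] unfolding P by metis
  obtain C2 where C2: "\<And>t. norm (tau_quotient m p (\<omega> * of_real t)) \<le> C2 * exp ((real m + real p) * \<bar>t\<bar>)"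
    using tau_quotient_bound_line[OF assms(1-3)] by blast
  define c where "c = real m + real p"
  define A where "A = (\<Sum>n=1..N. norm ((deriv ^^ (2 * n)) g 0 / fact (2 * n)) * (1 / s) ^ (2 * Suc N - 2 * n))"
  have C2': "C2 \<ge> 0" using C2[of 0] by simp
  have A: "A \<ge> 0" unfolding A_def using s by (intro sum_nonneg mult_nonneg_nonneg) auto
  define C where "C = max C1 (C2 * (1 / s) ^ (2 * N + 1) + A)"
  have C: "C \<ge> 0" unfolding C_def using C2' A s by (intro max.coboundedI2 add_nonneg_nonneg mult_nonneg_nonneg) auto
  have tn: "t ^ (2 * Suc N) \<ge> 0" for t :: real by (rule zero_le_even_power) simp
  have E: "exp (c * \<bar>t\<bar>) \<ge> 1" for t by (simp add: c_def)
  have "norm (g (\<omega> * of_real t) - P (\<omega> * of_real t)) \<le> C * t ^ (2 * Suc N) * exp (c * \<bar>t\<bar>)" for t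
  proof (cases "\<bar>t\<bar> \<le> s")
    case True
    hence "norm (g (\<omega> * of_real t) - P (\<omega> * of_real t)) \<le> C1 * \<bar>t\<bar> ^ (2 * Suc N)"
      using C1[of "\<omega> * of_real t"] by (simp add: norm_mult \<omega>_facts)
    also have "\<dots> \<le> C * t ^ (2 * Suc N)"
      unfolding power_even_abs[OF dvd_triv_left] by (intro mult_right_mono tn) (simp add: C_def)
    also have "\<dots> = C * t ^ (2 * Suc N) * 1" by simp
    also have "\<dots> \<le> C * t ^ (2 * Suc N) * exp (c * \<bar>t\<bar>)"
      by (intro mult_left_mono E mult_nonneg_nonneg C tn)
    finally show ?thesis .
  next
    case False
    \<comment> \<open>Away from \<open>0\<close> any power of degree at most \<open>2 N + 2\<close> is dominated by the top one.\<close>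
    have pw: "\<bar>t\<bar> ^ k \<le> (1 / s) ^ (2 * Suc N - k) * t ^ (2 * Suc N)" if "k \<le> 2 * Suc N" for k
    proof -
      have "1 \<le> \<bar>t\<bar> / s" using False s by simp
      hence "1 \<le> (\<bar>t\<bar> / s) ^ (2 * Suc N - k)" by (rule one_le_power)
      hence "\<bar>t\<bar> ^ k * 1 \<le> \<bar>t\<bar> ^ k * (\<bar>t\<bar> / s) ^ (2 * Suc N - k)" by (intro mult_left_mono) auto
      also have "\<dots> = (1 / s) ^ (2 * Suc N - k) * (\<bar>t\<bar> ^ k * \<bar>t\<bar> ^ (2 * Suc N - k))" by (simp add: power_divide)
      also have "\<bar>t\<bar> ^ k * \<bar>t\<bar> ^ (2 * Suc N - k) = \<bar>t\<bar> ^ (2 * Suc N)"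
        unfolding power_add[symmetric] using that by simp
      also have "\<dots> = t ^ (2 * Suc N)" by (rule power_even_abs) simp
      finally show ?thesis by simp
    qed
    have g1: "norm (g (\<omega> * of_real t)) \<le> C2 * (1 / s) ^ (2 * N + 1) * t ^ (2 * Suc N) * exp (c * \<bar>t\<bar>)"
    proof -
      have "norm (g (\<omega> * of_real t)) \<le> \<bar>t\<bar> ^ 1 * (C2 * exp (c * \<bar>t\<bar>))"
        unfolding g_def c_def using C2[of t] by (simp add: norm_mult \<omega>_facts mult_left_mono)
      also have "\<dots> \<le> ((1 / s) ^ (2 * Suc N - 1) * t ^ (2 * Suc N)) * (C2 * exp (c * \<bar>t\<bar>))"
        using pw[of 1] C2' by (intro mult_right_mono) auto
      finally show ?thesis by (simp add: mult_ac)
    qed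
    have "norm (P (\<omega> * of_real t)) \<le> (\<Sum>n=1..N. norm ((deriv ^^ (2 * n)) g 0 / fact (2 * n)) * \<bar>t\<bar> ^ (2 * n))"
      unfolding P_def by (rule sum_norm_le) (simp add: norm_mult norm_power \<omega>_facts norm_divide)
    also have "\<dots> \<le> (\<Sum>n=1..N. norm ((deriv ^^ (2 * n)) g 0 / fact (2 * n)) * ((1 / s) ^ (2 * Suc N - 2 * n) * t ^ (2 * Suc N)))"
      by (intro sum_mono mult_left_mono pw) auto
    also have "\<dots> = A * t ^ (2 * Suc N) * 1" by (simp only: A_def mult_1_right sum_distrib_right mult.assoc)
    also have "\<dots> \<le> A * t ^ (2 * Suc N) * exp (c * \<bar>t\<bar>)"
      by (intro mult_left_mono E mult_nonneg_nonneg A tn)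
    finally have P1: "norm (P (\<omega> * of_real t)) \<le> A * t ^ (2 * Suc N) * exp (c * \<bar>t\<bar>)" .
    have "norm (g (\<omega> * of_real t) - P (\<omega> * of_real t)) \<le>
       C2 * (1 / s) ^ (2 * N + 1) * t ^ (2 * Suc N) * exp (c * \<bar>t\<bar>) + A * t ^ (2 * Suc N) * exp (c * \<bar>t\<bar>)"
      by (rule order_trans[OF norm_triangle_ineq4 add_mono[OF g1 P1]])
    also have "\<dots> = (C2 * (1 / s) ^ (2 * N + 1) + A) * (t ^ (2 * Suc N) * exp (c * \<bar>t\<bar>))" by (simp add: algebra_simps)
    also have "\<dots> \<le> C * (t ^ (2 * Suc N) * exp (c * \<bar>t\<bar>))"
      by (intro mult_right_mono mult_nonneg_nonneg tn) (simp_all add: C_def)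
    finally show ?thesis by simp
  qed
  thus ?thesis using that unfolding P_def by blast
qed


section \<open>Shifting a diagonal line of integration\<close>

lemma not_in_closed_segment_of_orientation:
  assumes "0 < Im ((b - a) * cnj (b - z))"
  shows "z \<notin> closed_segment a b"
proof
  assume "z \<in> closed_segment a b"
  then obtain u where "z = (1 - u) *\<^sub>R a + u *\<^sub>R b" by (auto simp: closed_segment_def)
  hence eq: "b - z = of_real (1 - u) * (b - a)" by (simp add: scaleR_conv_of_real algebra_simps)
  have "Im ((b - a) * cnj (b - z)) = 0" unfolding eq by (simp add: algebra_simps)
  thus False using assms by simp
qed

text \<open>Each side contributes a real part strictly between \<open>0\<close> and \<open>1/2\<close> when the point lies to its left. The total is an integer strictly between \<open>0\<close> and \<open>2\<close>.\<close>

lemma winding_number_quadrilateral: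
  assumes "0 < Im ((b - a) * cnj (b - z))" "0 < Im ((c - b) * cnj (c - z))"
    "0 < Im ((d - c) * cnj (d - z))" "0 < Im ((a - d) * cnj (a - z))"
  shows "winding_number (linepath a b +++ linepath b c +++ linepath c d +++ linepath d a) z = 1"
proof -
  let ?g = "linepath a b +++ linepath b c +++ linepath c d +++ linepath d a"
  have nz: "z \<notin> closed_segment a b" "z \<notin> closed_segment b c" "z \<notin> closed_segment c d" "z \<notin> closed_segment d a"
    by (rule assms[THEN not_in_closed_segment_of_orientation])+
  have "winding_number ?g z = winding_number (linepath a b) z + winding_number (linepath b c) z
        + winding_number (linepath c d) z + winding_number (linepath d a) z"
    using nz by (simp add: winding_number_join path_image_join)
  moreover note winding_number_linepath_pos_lt[OF assms(1)] winding_number_linepath_pos_lt[OF assms(2)]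
    winding_number_linepath_pos_lt[OF assms(3)] winding_number_linepath_pos_lt[OF assms(4)]
    winding_number_lt_half_linepath[OF nz(1)] winding_number_lt_half_linepath[OF nz(2)]
    winding_number_lt_half_linepath[OF nz(3)] winding_number_lt_half_linepath[OF nz(4)]
  ultimately have "0 < Re (winding_number ?g z)" "Re (winding_number ?g z) < 2" by auto
  moreover have "winding_number ?g z \<in> \<int>"
    by (rule integer_winding_number) (use nz in \<open>auto simp: path_image_join\<close>)
  ultimately show ?thesis by (auto simp: Ints_def)
qed

lemma contour_integral_diagonal_segment:
  assumes int: "integrable lborel (\<lambda>t. f (c + \<omega> * of_real t))" and "n > 0"
    and cont: "continuous_on (closed_segment (c - \<omega> * of_real n) (c + \<omega> * of_real n)) f"
  shows "contour_integral (linepath (c - \<omega> * of_real n) (c + \<omega> * of_real n)) f =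
     (\<integral>t. indicator {-n..n} t *\<^sub>R (\<omega> * f (c + \<omega> * of_real t)) \<partial>lborel)"
proof -
  let ?I = "\<integral>t. indicator {-n..n} t *\<^sub>R (\<omega> * f (c + \<omega> * of_real t)) \<partial>lborel"
  have si: "set_integrable lborel {-n..n} (\<lambda>t. \<omega> * f (c + \<omega> * of_real t))"
    unfolding set_integrable_def by (intro integrable_mult_indicator integrable_mult_right int) auto
  have "((\<lambda>t. \<omega> * f (c + \<omega> * of_real t)) has_integral ?I) {-n..n}"
    using integrable_integral[OF set_borel_integral_eq_integral(1)[OF si]]
    unfolding set_borel_integral_eq_integral(2)[OF si, symmetric] set_lebesgue_integral_def .
  hence "((\<lambda>z. \<omega> * f (c + \<omega> * z)) has_contour_integral ?I) (linepath (of_real (-n)) (of_real n))"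
    using \<open>n > 0\<close> by (subst has_contour_integral_linepath_Reals_iff) auto
  hence "(f has_contour_integral ?I) (linepath (c - \<omega> * of_real n) (c + \<omega> * of_real n))"
    unfolding has_contour_integral_linepath
    by (simp add: linepath_def scaleR_conv_of_real algebra_simps)
  thus ?thesis by (rule contour_integral_unique)
qed

lemma tendsto_truncated_integral:
  fixes f :: "real \<Rightarrow> complex"
  assumes "integrable lborel f"
  shows "(\<lambda>n. \<integral>t. indicator {- real n..real n} t *\<^sub>R f t \<partial>lborel) \<longlonglongrightarrow> (\<integral>t. f t \<partial>lborel)"
proof (rule integral_dominated_convergence[where w = "\<lambda>t. norm (f t)"])
  show "AE t in lborel. (\<lambda>n. indicator {- real n..real n} t *\<^sub>R f t) \<longlonglongrightarrow> f t"
  proof (rule AE_I2)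
    fix t :: real
    obtain N :: nat where "\<bar>t\<bar> \<le> real N" using real_arch_simple by blast
    hence "\<forall>n\<ge>N. indicator {- real n..real n} t *\<^sub>R f t = f t" by (auto simp: indicator_def)
    hence "\<forall>\<^sub>F n in sequentially. indicator {- real n..real n} t *\<^sub>R f t = f t"
      by (auto simp: eventually_sequentially)
    thus "(\<lambda>n. indicator {- real n..real n} t *\<^sub>R f t) \<longlonglongrightarrow> f t" by (rule tendsto_eventually)
  qed
qed (use assms in \<open>auto simp: indicator_def intro!: integrable_norm borel_measurable_scaleR\<close>)

text \<open>The residue theorem on the parallelograms with vertices \<open>- n \<omega>\<close>, \<open>n \<omega>\<close>, \<open>n \<omega> + pi \<i>\<close>, \<open>- n \<omega> + pi \<i>\<close>. As \<open>n\<close> grows, the two vertical sides disappear. The strip is convex, so winding numbers around points outside it vanish, and the margin \<open>\<delta>\<close> makes it an open set containing both lines.\<close>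

lemma diagonal_contour_shift:
  fixes f :: "complex \<Rightarrow> complex" and \<delta> :: real and B :: "nat \<Rightarrow> real"
  assumes "\<delta> > 0" "finite pts"
    and pts: "\<And>q. q \<in> pts \<Longrightarrow> Re q = 0 \<and> 0 < Im q \<and> Im q < pi"
    and hol: "f holomorphic_on {w. - \<delta> < Im w - Re w \<and> Im w - Re w < pi + \<delta>} - pts"
    and int0: "integrable lborel (\<lambda>t. f (\<omega> * of_real t))"
    and int1: "integrable lborel (\<lambda>t. f (of_real pi * \<i> + \<omega> * of_real t))"
    and side: "\<And>n s. n > 0 \<Longrightarrow> 0 \<le> s \<Longrightarrow> s \<le> pi \<Longrightarrow> norm (f (\<omega> * of_real (real n) + of_real s * \<i>)) \<le> B n"
      "\<And>n s. n > 0 \<Longrightarrow> 0 \<le> s \<Longrightarrow> s \<le> pi \<Longrightarrow> norm (f (\<omega> * of_real (- real n) + of_real s * \<i>)) \<le> B n"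
    and B: "B \<longlonglongrightarrow> 0"
  shows "\<omega> * (\<integral>t. f (\<omega> * of_real t) \<partial>lborel) - \<omega> * (\<integral>t. f (of_real pi * \<i> + \<omega> * of_real t) \<partial>lborel)
      = 2 * of_real pi * \<i> * (\<Sum>q\<in>pts. residue f q)"
proof -
  define S where "S = {w. - \<delta> < Im w - Re w \<and> Im w - Re w < pi + \<delta>}"
  have S_eq: "S = {w. inner (Complex (-1) 1) w > - \<delta>} \<inter> {w. inner (Complex (-1) 1) w < pi + \<delta>}"
    by (auto simp: S_def inner_complex_def)
  have openS: "open S" unfolding S_eq by (intro open_Int open_halfspace_lt open_halfspace_gt)
  have convS: "convex S" unfolding S_eq by (intro convex_Int convex_halfspace_lt convex_halfspace_gt)
  have contS: "continuous_on (S - pts) f" using hol holomorphic_on_imp_continuous_on by (simp add: S_def)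
  define u where "u = of_real pi * \<i>"
  define I0 where "I0 n = (\<integral>t. indicator {- real n..real n} t *\<^sub>R (\<omega> * f (0 + \<omega> * of_real t)) \<partial>lborel)" for n :: nat
  define I1 where "I1 n = (\<integral>t. indicator {- real n..real n} t *\<^sub>R (\<omega> * f (u + \<omega> * of_real t)) \<partial>lborel)" for n :: nat
  define A where "A n = \<omega> * of_real (real n)" for n
  define s2 where "s2 n = contour_integral (linepath (A n) (A n + u)) f" for n
  define s4 where "s4 n = contour_integral (linepath (u - A n) (- A n)) f" for n
  have ReA: "Re (A n) = sqrt 2 / 2 * real n" "Im (A n) = sqrt 2 / 2 * real n" for n by (auto simp: A_def \<omega>_facts)
  have seg1: "closed_segment (- A n) (A n) \<subseteq> S - pts" for n
  proof
    fix w assume "w \<in> closed_segment (- A n) (A n)"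
    then obtain x where "w = (1 - x) *\<^sub>R (- A n) + x *\<^sub>R A n" by (auto simp: closed_segment_def)
    hence "Im w - Re w = 0" by (simp add: ReA)
    moreover have "pi + \<delta> > 0" using \<open>\<delta> > 0\<close> pi_gt_zero by (rule add_pos_pos[rotated])
    ultimately show "w \<in> S - pts" using pts[of w] \<open>\<delta> > 0\<close> by (auto simp: S_def)
  qed
  have seg3: "closed_segment (u - A n) (u + A n) \<subseteq> S - pts" for n
  proof
    fix w assume "w \<in> closed_segment (u - A n) (u + A n)"
    then obtain x where w: "w = (1 - x) *\<^sub>R (u - A n) + x *\<^sub>R (u + A n)" by (auto simp: closed_segment_def)
    have "Im w - Re w = pi" unfolding w by (simp add: ReA u_def algebra_simps)
    moreover have "- \<delta> < pi" using \<open>\<delta> > 0\<close> pi_gt_zero by linarith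
    ultimately show "w \<in> S - pts" using pts[of w] \<open>\<delta> > 0\<close> by (auto simp: S_def)
  qed
  have vert: "\<exists>s. 0 \<le> s \<and> s \<le> pi \<and> w = a + of_real s * \<i>" if "w \<in> closed_segment a (a + u)" for w a
  proof -
    obtain x where x: "0 \<le> x" "x \<le> 1" "w = (1 - x) *\<^sub>R a + x *\<^sub>R (a + u)"
      using \<open>w \<in> closed_segment a (a + u)\<close> by (auto simp: closed_segment_def)
    thus ?thesis
      by (intro exI[of _ "x * pi"]) (auto simp: u_def scaleR_conv_of_real algebra_simps intro: mult_left_le_one_le)
  qed
  have vertS: "a + of_real s * \<i> \<in> S - pts" if "Im a = Re a" "Re a \<noteq> 0" "0 \<le> s" "s \<le> pi" for a s
    using that pts[of "a + of_real s * \<i>"] \<open>\<delta> > 0\<close> by (auto simp: S_def)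
  have seg2: "closed_segment (A n) (A n + u) \<subseteq> S - pts" if "n > 0" for n
    using vert[of _ "A n"] vertS[of "A n"] that by (auto simp: ReA)
  have seg4: "closed_segment (- A n) (- A n + u) \<subseteq> S - pts" if "n > 0" for n
    using vert[of _ "- A n"] vertS[of "- A n"] that by (auto simp: ReA)
  have seg4': "closed_segment (u - A n) (- A n) \<subseteq> S - pts" if "n > 0" for n
    using seg4[OF that] by (simp add: closed_segment_commute add.commute)
  have ci: "f contour_integrable_on linepath a b" if "closed_segment a b \<subseteq> S - pts" for a b
    by (rule contour_integrable_continuous_linepath[OF continuous_on_subset[OF contS that]])
  have main: "I0 n + s2 n - I1 n + s4 n = 2 * of_real pi * \<i> * (\<Sum>q\<in>pts. residue f q)" if n: "n > 0" for n
  proof -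
    let ?g = "linepath (- A n) (A n) +++ linepath (A n) (u + A n) +++ linepath (u + A n) (u - A n) +++ linepath (u - A n) (- A n)"
    have seg3': "closed_segment (u + A n) (u - A n) \<subseteq> S - pts" using seg3 by (simp add: closed_segment_commute)
    have seg2': "closed_segment (A n) (u + A n) \<subseteq> S - pts" using seg2[OF n] by (simp add: add.commute)
    have im: "path_image ?g \<subseteq> S - pts"
      using seg1[of n] seg2' seg3' seg4'[OF n] by (simp add: path_image_join)
    have wn: "winding_number ?g q = 1" if "q \<in> pts" for q
    proof -
      note q = pts[OF that]
      have r: "sqrt 2 * real n > 0" using n by simp
      show ?thesis
      proof (rule winding_number_quadrilateral)
        have e1: "Im ((A n - - A n) * cnj (A n - q)) = sqrt 2 * real n * Im q"
          using q by (simp add: ReA algebra_simps)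
        show "0 < Im ((A n - - A n) * cnj (A n - q))" unfolding e1 using q r by simp
        have e2: "Im ((u + A n - A n) * cnj (u + A n - q)) = pi * (sqrt 2 * real n / 2)"
          using q by (simp add: ReA u_def algebra_simps)
        show "0 < Im ((u + A n - A n) * cnj (u + A n - q))" unfolding e2 using r by simp
        have e3: "Im ((u - A n - (u + A n)) * cnj (u - A n - q)) = sqrt 2 * real n * (pi - Im q)"
          using q by (simp add: ReA u_def algebra_simps)
        show "0 < Im ((u - A n - (u + A n)) * cnj (u - A n - q))" unfolding e3 using q r by simp
        have e4: "Im ((- A n - (u - A n)) * cnj (- A n - q)) = pi * (sqrt 2 * real n / 2)"
          using q by (simp add: ReA u_def algebra_simps)
        show "0 < Im ((- A n - (u - A n)) * cnj (- A n - q))" unfolding e4 using r by simp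
      qed
    qed
    have "contour_integral ?g f = of_real (2 * pi) * \<i> * (\<Sum>q\<in>pts. winding_number ?g q * residue f q)"
    proof (rule Residue_theorem[OF openS convex_connected[OF convS] \<open>finite pts\<close>])
      show "f holomorphic_on S - pts" using hol by (simp add: S_def)
      show "\<forall>z. z \<notin> S \<longrightarrow> winding_number ?g z = 0"
        using winding_number_zero_outside[OF _ convS, of ?g] im by auto
    qed (use im in auto)
    also have "(\<Sum>q\<in>pts. winding_number ?g q * residue f q) = (\<Sum>q\<in>pts. residue f q)" using wn by simp
    also have "contour_integral ?g f = contour_integral (linepath (- A n) (A n)) f +
        (contour_integral (linepath (A n) (u + A n)) f + (contour_integral (linepath (u + A n) (u - A n)) f
         + contour_integral (linepath (u - A n) (- A n)) f))"
      using ci[OF seg1[of n]] ci[OF seg2'] ci[OF seg3'] ci[OF seg4'[OF n]]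
      by (simp add: contour_integrable_joinI)
    also have "contour_integral (linepath (u + A n) (u - A n)) f = - contour_integral (linepath (u - A n) (u + A n)) f"
      by (rule contour_integral_reverse_linepath[OF continuous_on_subset[OF contS seg3']])
    also have "contour_integral (linepath (u - A n) (u + A n)) f = I1 n"
      unfolding I1_def A_def
      by (rule contour_integral_diagonal_segment)
         (use int1 n continuous_on_subset[OF contS seg3[of n]] in \<open>auto simp: u_def A_def\<close>)
    also have "contour_integral (linepath (- A n) (A n)) f = I0 n"
      using contour_integral_diagonal_segment[of f 0 "real n"] int0 n continuous_on_subset[OF contS seg1[of n]]
      by (simp add: I0_def A_def)
    finally show ?thesis unfolding of_real_mult of_real_numeral by (simp add: s2_def s4_def add.commute algebra_simps)
  qed
  have lim2: "s2 \<longlonglongrightarrow> 0"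
  proof (rule Lim_null_comparison)
    show "\<forall>\<^sub>F n in sequentially. norm (s2 n) \<le> B n * pi"
      using eventually_gt_at_top[of 0]
    proof eventually_elim
      case (elim n)
      have bd: "norm (f x) \<le> B n" if "x \<in> closed_segment (A n) (A n + u)" for x
        using vert[OF that] side(1)[OF elim] by (auto simp: A_def)
      have "norm (s2 n) \<le> B n * norm (A n + u - A n)"
        unfolding s2_def by (rule contour_integral_bound_linepath[OF ci[OF seg2[OF elim]]])
          (use bd order_trans[OF norm_ge_zero bd[of "A n"]] in auto)
      thus ?case by (simp add: u_def norm_mult)
    qed
    show "(\<lambda>n. B n * pi) \<longlonglongrightarrow> 0" using tendsto_mult_right[OF B, of pi] by simp
  qed
  have lim4: "s4 \<longlonglongrightarrow> 0"
  proof (rule Lim_null_comparison)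
    show "\<forall>\<^sub>F n in sequentially. norm (s4 n) \<le> B n * pi"
      using eventually_gt_at_top[of 0]
    proof eventually_elim
      case (elim n)
      have bd: "norm (f x) \<le> B n" if "x \<in> closed_segment (u - A n) (- A n)" for x
      proof -
        have "x \<in> closed_segment (- A n) (- A n + u)" using that by (simp add: closed_segment_commute add.commute)
        from vert[OF this] show ?thesis using side(2)[OF elim] by (auto simp: A_def)
      qed
      have "norm (s4 n) \<le> B n * norm (- A n - (u - A n))"
        unfolding s4_def by (rule contour_integral_bound_linepath[OF ci[OF seg4'[OF elim]]])
          (use bd order_trans[OF norm_ge_zero bd[of "- A n"]] in auto)
      thus ?case by (simp add: u_def norm_mult)
    qed
    show "(\<lambda>n. B n * pi) \<longlonglongrightarrow> 0" using tendsto_mult_right[OF B, of pi] by simp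
  qed
  have "I0 \<longlonglongrightarrow> (\<integral>t. \<omega> * f (0 + \<omega> * of_real t) \<partial>lborel)"
    unfolding I0_def by (intro tendsto_truncated_integral integrable_mult_right) (use int0 in auto)
  moreover have "I1 \<longlonglongrightarrow> (\<integral>t. \<omega> * f (u + \<omega> * of_real t) \<partial>lborel)"
    unfolding I1_def by (intro tendsto_truncated_integral integrable_mult_right) (use int1 in \<open>auto simp: u_def\<close>)
  ultimately have "(\<lambda>n. I0 n + s2 n - I1 n + s4 n) \<longlonglongrightarrow>
     (\<integral>t. \<omega> * f (0 + \<omega> * of_real t) \<partial>lborel) + 0 - (\<integral>t. \<omega> * f (u + \<omega> * of_real t) \<partial>lborel) + 0"
    by (intro tendsto_intros lim2 lim4)
  moreover have "(\<lambda>n. I0 n + s2 n - I1 n + s4 n) \<longlonglongrightarrow> 2 * of_real pi * \<i> * (\<Sum>q\<in>pts. residue f q)"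
    by (rule tendsto_eventually, rule eventually_mono[OF eventually_gt_at_top[of 0]]) (rule main)
  ultimately show ?thesis using LIMSEQ_unique by (fastforce simp: u_def)
qed


section \<open>The Gauss sum as an integral\<close>

lemma integral_eq_of_equal_even_parts:
  fixes f g :: "real \<Rightarrow> complex"
  assumes "integrable lborel f" "integrable lborel g" "\<And>t. f t + f (- t) = g t + g (- t)"
  shows "(\<integral>t. f t \<partial>lborel) = (\<integral>t. g t \<partial>lborel)"
proof -
  have *: "integrable lborel (\<lambda>t. h (- t)) \<and> (\<integral>t. h (- t) \<partial>lborel) = (\<integral>t. h t \<partial>lborel)"
    if "integrable lborel h" for h :: "real \<Rightarrow> complex"
    using lborel_integral_real_affine[of "-1" h 0] lborel_integrable_real_affine[OF that, of "-1" 0] by simp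
  have "(\<integral>t. f t + f (- t) \<partial>lborel) = 2 * (\<integral>t. f t \<partial>lborel)"
    using *[OF assms(1)] assms(1) by simp
  moreover have "(\<integral>t. g t + g (- t) \<partial>lborel) = 2 * (\<integral>t. g t \<partial>lborel)"
    using *[OF assms(2)] assms(2) by simp
  ultimately show ?thesis using assms(3) by simp
qed

lemma sinh_scaled_diagonal_nonzero:
  assumes "c > 0" "t \<noteq> 0"
  shows "sinh (of_real c * (\<omega> * of_real t)) \<noteq> 0"
proof -
  have "0 < \<bar>Re (of_real c * (\<omega> * of_real t))\<bar>" using assms by (simp add: \<omega>_facts abs_mult)
  also have "\<dots> \<le> norm (sinh (of_real c * (\<omega> * of_real t)))" by (rule norm_sinh_ge)
  finally show ?thesis by auto
qed

text \<open>A geometric series in \<open>exp (2 m p w)\<close>; the two signs combine into \<open>2 sinh (p w)\<close>.\<close>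

lemma signed_sum_exp:
  assumes "sinh (of_nat m * of_nat p * w) \<noteq> 0"
  shows "signed_sum m p k (\<lambda>x. exp (of_int x * w)) =
    exp (of_nat m * w) * (2 * sinh (of_nat p * w)) * sinh (of_nat m * of_nat p * of_nat k * w) / sinh (of_nat m * of_nat p * w)"
proof -
  define v where "v = of_nat m * of_nat p * w"
  have geo: "(\<Sum>l<k. exp (2 * of_nat l * v)) * exp (- (of_nat k - 1) * v) = sinh (of_nat k * v) / sinh v"
  proof -
    have e: "exp (2 * v) \<noteq> 1"
    proof
      assume "exp (2 * v) = 1"
      hence "exp v * exp v = exp v * exp (- v)" by (simp flip: exp_add)
      hence "sinh v = 0" by (simp add: sinh_field_def)
      thus False using assms by (simp add: v_def)
    qed
    have half: "exp (2 * x) - 1 = exp x * (2 * sinh x)" for x :: complex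
    proof -
      have "exp x * (2 * sinh x) = exp x * exp x - exp x * exp (- x)"
        by (simp add: sinh_field_def right_diff_distrib)
      thus ?thesis by (simp flip: exp_add)
    qed
    have "(\<Sum>l<k. exp (2 * of_nat l * v)) = (\<Sum>l<k. exp (2 * v) ^ l)"
      by (simp add: exp_of_nat_mult[symmetric] mult_ac)
    also have "\<dots> = (exp (2 * v) ^ k - 1) / (exp (2 * v) - 1)"
      using e by (simp add: geometric_sum)
    also have "exp (2 * v) ^ k = exp (2 * of_nat k * v)" by (simp add: exp_of_nat_mult[symmetric] mult_ac)
    also have "exp (2 * of_nat k * v) - 1 = exp (of_nat k * v) * (2 * sinh (of_nat k * v))"
      using half[of "of_nat k * v"] by (simp only: mult.assoc)
    also have "exp (2 * v) - 1 = exp v * (2 * sinh v)"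
      by (rule half)
    finally have "(\<Sum>l<k. exp (2 * of_nat l * v)) * exp (- (of_nat k - 1) * v) =
       (exp (of_nat k * v) * exp (- (of_nat k - 1) * v) / exp v) * (sinh (of_nat k * v) / sinh v)"
      by simp
    also have "exp (of_nat k * v) * exp (- (of_nat k - 1) * v) / exp v = 1"
      by (simp add: algebra_simps flip: exp_add exp_diff)
    finally show ?thesis by simp
  qed
  have x: "exp (of_int (knot_exponent m p k s l) * w) =
      exp (of_nat m * w) * exp (of_int s * of_nat p * w) * (exp (2 * of_nat l * v) * exp (- (of_nat k - 1) * v))" for s l
    unfolding exp_add[symmetric]
    by (rule arg_cong[of _ _ exp]) (simp add: knot_exponent_def v_def algebra_simps)
  have "signed_sum m p k (\<lambda>x. exp (of_int x * w)) =
      exp (of_nat m * w) * (exp (of_nat p * w) - exp (- (of_nat p * w))) *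
        ((\<Sum>l<k. exp (2 * of_nat l * v)) * exp (- (of_nat k - 1) * v))"
    unfolding signed_sum_def x by (simp add: sum_distrib_left sum_distrib_right algebra_simps)
  also have "exp (of_nat p * w) - exp (- (of_nat p * w)) = 2 * sinh (of_nat p * w)" by (simp add: sinh_field_def)
  finally show ?thesis unfolding geo by (simp add: v_def mult_ac)
qed

text \<open>The Gaussian is centred at its saddle point \<open>pi \<i>\<close>. On the line through \<open>0\<close> the linear term of its exponent restores the factor \<open>exp (m p k w)\<close>.\<close>

definition knot_integrand :: "nat \<Rightarrow> nat \<Rightarrow> real \<Rightarrow> complex \<Rightarrow> complex" where
  "knot_integrand m p K w = w\<^sup>2 * tau_quotient m p w * exp (\<i> * of_real K * (w - of_real pi * \<i>)\<^sup>2)"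

lemma knot_integrand_on_diagonal:
  "exp (\<i> * of_real (K * pi\<^sup>2)) * knot_integrand m p K (\<omega> * of_real t) =
    \<i> * (exp (-K * t\<^sup>2) *\<^sub>R (of_real t ^ 2 * tau_quotient m p (\<omega> * of_real t) * exp (2 * of_real (pi * K) * (\<omega> * of_real t))))"
proof -
  have w2: "(\<omega> * of_real t)\<^sup>2 = \<i> * of_real t ^ 2" by (simp add: power_mult_distrib \<omega>_facts)
  have "\<i> * of_real (K * pi\<^sup>2) + \<i> * of_real K * (\<omega> * of_real t - of_real pi * \<i>)\<^sup>2
      = \<i> * of_real K * (\<omega> * of_real t)\<^sup>2 + 2 * of_real (pi * K) * (\<omega> * of_real t)"
    by (simp add: power2_eq_square algebra_simps)
  also have "\<dots> = of_real (-K * t\<^sup>2) + 2 * of_real (pi * K) * (\<omega> * of_real t)"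
  proof -
    have "\<i> * of_real K * (\<i> * of_real t ^ 2) = (\<i> * \<i>) * (of_real K * of_real t ^ 2)" by (simp only: mult_ac)
    thus ?thesis unfolding w2 by simp
  qed
  finally have e: "exp (\<i> * of_real (K * pi\<^sup>2)) * exp (\<i> * of_real K * (\<omega> * of_real t - of_real pi * \<i>)\<^sup>2)
      = of_real (exp (-K * t\<^sup>2)) * exp (2 * of_real (pi * K) * (\<omega> * of_real t))"
    unfolding exp_of_real[symmetric] exp_add[symmetric] by (rule arg_cong)
  have "exp (\<i> * of_real (K * pi\<^sup>2)) * knot_integrand m p K (\<omega> * of_real t) =
     (\<omega> * of_real t)\<^sup>2 * tau_quotient m p (\<omega> * of_real t) *
      (exp (\<i> * of_real (K * pi\<^sup>2)) * exp (\<i> * of_real K * (\<omega> * of_real t - of_real pi * \<i>)\<^sup>2))"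
    by (simp add: knot_integrand_def mult_ac)
  thus ?thesis unfolding e w2 by (simp add: scaleR_conv_of_real mult_ac)
qed

lemma diagonal_integrable:
  assumes "m > 0" "p > 0" "coprime m p" "K > 0"
  shows "integrable lborel (\<lambda>t. exp (-K * t\<^sup>2) *\<^sub>R
     (of_real t ^ 2 * tau_quotient m p (\<omega> * of_real t) * exp (2 * of_real (pi * K) * (\<omega> * of_real t))))"
proof -
  obtain C where C: "\<And>t. norm (tau_quotient m p (\<omega> * of_real t)) \<le> C * exp ((real m + real p) * \<bar>t\<bar>)"
    using tau_quotient_bound_line[OF assms(1-3)] by blast
  show ?thesis
  proof (rule gaussian_integral_exponential_growth(1)[OF assms(4), where C = C and j = 1 and c = "real m + real p + 2 * pi * K"])
    fix t :: real
    have "norm (exp (2 * of_real (pi * K) * (\<omega> * of_real t))) \<le> exp (norm (2 * of_real (pi * K) * (\<omega> * of_real t)))"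
      by (rule norm_exp)
    also have "norm (2 * of_real (pi * K) * (\<omega> * of_real t)) = 2 * pi * K * \<bar>t\<bar>"
      using assms(4) by (simp add: norm_mult \<omega>_facts)
    finally have e: "norm (exp (2 * of_real (pi * K) * (\<omega> * of_real t))) \<le> exp (2 * pi * K * \<bar>t\<bar>)" .
    have "norm (of_real t ^ 2 * tau_quotient m p (\<omega> * of_real t) * exp (2 * of_real (pi * K) * (\<omega> * of_real t)))
      \<le> (t\<^sup>2 * (C * exp ((real m + real p) * \<bar>t\<bar>))) * exp (2 * pi * K * \<bar>t\<bar>)"
      unfolding norm_mult
      by (intro mult_mono e mult_nonneg_nonneg order_trans[OF norm_ge_zero C] C) (auto simp: norm_power)
    also have "\<dots> = C * t ^ (2 * 1) * exp ((real m + real p + 2 * pi * K) * \<bar>t\<bar>)"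
      by (simp add: algebra_simps exp_add power2_eq_square)
    finally show "norm (of_real t ^ 2 * tau_quotient m p (\<omega> * of_real t) * exp (2 * of_real (pi * K) * (\<omega> * of_real t)))
      \<le> C * t ^ (2 * 1) * exp ((real m + real p + 2 * pi * K) * \<bar>t\<bar>)" .
  qed measurable
qed

lemma knot_integrand_integrable_at_0:
  assumes "m > 0" "p > 0" "coprime m p" "K > 0"
  shows "integrable lborel (\<lambda>t. knot_integrand m p K (\<omega> * of_real t))"
proof -
  have eq: "knot_integrand m p K (\<omega> * of_real t) = exp (- (\<i> * of_real (K * pi\<^sup>2))) * (\<i> * 
      (exp (-K * t\<^sup>2) *\<^sub>R (of_real t ^ 2 * tau_quotient m p (\<omega> * of_real t) * exp (2 * of_real (pi * K) * (\<omega> * of_real t)))))" for t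
  proof -
    have "exp (- (\<i> * of_real (K * pi\<^sup>2))) * exp (\<i> * of_real (K * pi\<^sup>2)) = 1" by (simp flip: exp_add)
    hence "exp (- (\<i> * of_real (K * pi\<^sup>2))) * (exp (\<i> * of_real (K * pi\<^sup>2)) * F) = F" for F
      by (metis mult.assoc mult_1)
    from this[of "knot_integrand m p K (\<omega> * of_real t)"] show ?thesis
      unfolding knot_integrand_on_diagonal by (rule sym)
  qed
  show ?thesis unfolding eq by (intro integrable_mult_right diagonal_integrable assms)
qed

text \<open>Each term of the Gauss sum is a Gaussian second moment; its contribution without \<open>x^2\<close> drops out by the vanishing of the signed sum. Under the integral, even parts may be exchanged: adding the values at \<open>w\<close> and \<open>- w\<close> turns \<open>exp (m w)\<close> into \<open>2 sinh (m w)\<close>, which completes \<open>\<tau>\<close>, and conversely \<open>2 sinh (m p k w)\<close> may be replaced by \<open>exp (m p k w)\<close>.\<close>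

lemma quadratic_gauss_sum_eq_integral:
  assumes "m > 0" "p > 0" "coprime m p" "k > 0"
  defines "K \<equiv> real m * real p * real k / (2 * pi)"
  shows "signed_sum m p k (\<lambda>x. of_int x ^ 2 * cis (pi * of_int x ^ 2 / (2 * real m * real p * real k))) =
     - 4 * of_real (K\<^sup>2 * sqrt (K / pi)) * exp (\<i> * of_real (K * pi\<^sup>2)) * (\<integral>t. knot_integrand m p K (\<omega> * of_real t) \<partial>lborel)"
    (is "?X = _")
proof -
  have K: "K > 0" using assms by (simp add: K_def)
  have mpk: "of_nat m * of_nat p * of_nat k = (2 * of_real (pi * K) :: complex)" by (simp add: K_def)
  define q where "q = complex_of_real (sqrt (pi / K) / (2 * K))"
  define c where "c x = cis (pi * of_int x ^ 2 / (2 * real m * real p * real k))" for x :: int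
  define G where "G x t = exp (-K * t\<^sup>2) *\<^sub>R (of_real t ^ 2 * exp (of_int x * \<omega> * of_real t))" for x :: int and t
  have Gint: "integrable lborel (G x)" for x
    unfolding G_def by (rule gaussian_second_moment_exp(1)[OF K])
  have Gval: "integral\<^sup>L lborel (G x) = q * c x + (q * \<i> / (2 * of_real K)) * (of_int x ^ 2 * c x)" for x
  proof -
    have y: "(of_int x * \<omega>)\<^sup>2 / (4 * of_real K) = \<i> * of_int x ^ 2 / (4 * of_real K)"
      by (simp add: power_mult_distrib \<omega>_facts)
    have "pi * of_int x ^ 2 / (2 * real m * real p * real k) = of_int x ^ 2 / (4 * K)"
      by (simp add: K_def mult_ac)
    hence c: "c x = exp (\<i> * of_int x ^ 2 / (4 * of_real K))"
      by (simp add: c_def cis_conv_exp)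
    show ?thesis
      unfolding G_def gaussian_second_moment_exp(2)[OF K] y c q_def by (simp add: algebra_simps)
  qed
  have "(\<integral>t. signed_sum m p k (\<lambda>x. G x t) \<partial>lborel) = signed_sum m p k (\<lambda>x. integral\<^sup>L lborel (G x))"
    unfolding signed_sum_def by (simp add: Gint)
  also have "\<dots> = q * \<i> / (2 * of_real K) * ?X"
    unfolding Gval signed_sum_add signed_sum_cmult c_def
    using signed_gauss_sum_vanishes[OF assms(1,2,4,3)] by simp
  finally have 1: "(\<integral>t. signed_sum m p k (\<lambda>x. G x t) \<partial>lborel) = q * \<i> / (2 * of_real K) * ?X" .
  define P where "P t = exp (-K * t\<^sup>2) *\<^sub>R
     (of_real t ^ 2 * tau_quotient m p (\<omega> * of_real t) * exp (2 * of_real (pi * K) * (\<omega> * of_real t)))" for t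
  have sG: "signed_sum m p k (\<lambda>x. G x t) = of_real (exp (-K * t\<^sup>2) * t\<^sup>2) * signed_sum m p k (\<lambda>x. exp (of_int x * (\<omega> * of_real t)))" for t
    unfolding signed_sum_cmult[symmetric] by (simp add: G_def scaleR_conv_of_real mult_ac)
  have "(\<integral>t. signed_sum m p k (\<lambda>x. G x t) \<partial>lborel) = (\<integral>t. P t \<partial>lborel)"
  proof (rule integral_eq_of_equal_even_parts)
    show "integrable lborel (\<lambda>t. signed_sum m p k (\<lambda>x. G x t))"
      unfolding signed_sum_def by (intro Bochner_Integration.integrable_diff Bochner_Integration.integrable_sum Gint)
    show "integrable lborel P" unfolding P_def by (rule diagonal_integrable[OF assms(1-3) K])
    show "signed_sum m p k (\<lambda>x. G x t) + signed_sum m p k (\<lambda>x. G x (- t)) = P t + P (- t)" for t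
    proof (cases "t = 0")
      case True
      thus ?thesis by (simp add: sG P_def)
    next
      case False
      define w where "w = \<omega> * of_real t"
      have ne: "sinh (of_nat m * of_nat p * w) \<noteq> 0"
        using sinh_scaled_diagonal_nonzero[of "real m * real p" t] assms False by (simp add: w_def)
      hence ne': "sinh (of_nat m * of_nat p * (- w)) \<noteq> 0" by simp
      have mw: "\<omega> * of_real (- t) = - w" by (simp add: w_def)
      have "signed_sum m p k (\<lambda>x. G x t) + signed_sum m p k (\<lambda>x. G x (- t)) = of_real (exp (-K * t\<^sup>2) * t\<^sup>2) *
          (exp (of_nat m * w) * (2 * sinh (of_nat p * w)) * sinh (2 * of_real (pi * K) * w) / sinh (of_nat m * of_nat p * w)
           - exp (- (of_nat m * w)) * (2 * sinh (of_nat p * w)) * sinh (2 * of_real (pi * K) * w) / sinh (of_nat m * of_nat p * w))"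
        unfolding sG mw w_def[symmetric] signed_sum_exp[OF ne] signed_sum_exp[OF ne'] mpk by (simp add: algebra_simps)
      also have "\<dots> = of_real (exp (-K * t\<^sup>2) * t\<^sup>2) *
          ((exp (of_nat m * w) - exp (- (of_nat m * w))) * (2 * sinh (of_nat p * w)) * sinh (2 * of_real (pi * K) * w) / sinh (of_nat m * of_nat p * w))"
        by (simp add: algebra_simps diff_divide_distrib)
      also have "\<dots> = of_real (exp (-K * t\<^sup>2) * t\<^sup>2) * (tau_quotient m p w * (2 * sinh (2 * of_real (pi * K) * w)))"
      proof -
        have em: "exp (of_nat m * w) - exp (- (of_nat m * w)) = 2 * sinh (of_nat m * w)" by (simp add: sinh_field_def)
        show ?thesis unfolding em tau_quotient_def by simp
      qed
      also have "2 * sinh (2 * of_real (pi * K) * w) = exp (2 * of_real (pi * K) * w) - exp (- (2 * of_real (pi * K) * w))"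
        by (simp add: sinh_field_def)
      also have "of_real (exp (-K * t\<^sup>2) * t\<^sup>2) * (tau_quotient m p w * (exp (2 * of_real (pi * K) * w) - exp (- (2 * of_real (pi * K) * w)))) = P t + P (- t)"
        unfolding P_def mw w_def[symmetric] by (simp add: scaleR_conv_of_real algebra_simps)
      finally show ?thesis .
    qed
  qed
  also have "(\<integral>t. P t \<partial>lborel) = - \<i> * (exp (\<i> * of_real (K * pi\<^sup>2)) * (\<integral>t. knot_integrand m p K (\<omega> * of_real t) \<partial>lborel))"
  proof -
    have "P t = - \<i> * (exp (\<i> * of_real (K * pi\<^sup>2)) * knot_integrand m p K (\<omega> * of_real t))" for t
      unfolding knot_integrand_on_diagonal P_def by (simp add: mult.assoc[symmetric])
    thus ?thesis by simp
  qed
  finally have 2: "q * \<i> / (2 * of_real K) * ?X = - \<i> * (exp (\<i> * of_real (K * pi\<^sup>2)) * (\<integral>t. knot_integrand m p K (\<omega> * of_real t) \<partial>lborel))"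
    using 1 by simp
  have qK: "q / (2 * of_real K) * of_real (4 * K\<^sup>2 * sqrt (K / pi)) = 1"
  proof -
    have "sqrt (pi / K) * sqrt (K / pi) = 1" using K by (simp flip: real_sqrt_mult)
    hence one: "sqrt (pi / K) / (2 * K) / (2 * K) * (4 * K\<^sup>2 * sqrt (K / pi)) = 1"
      using K by (simp add: field_simps power2_eq_square)
    have "q / (2 * of_real K) * of_real (4 * K\<^sup>2 * sqrt (K / pi)) =
        of_real (sqrt (pi / K) / (2 * K) / (2 * K) * (4 * K\<^sup>2 * sqrt (K / pi)))"
      by (simp add: q_def)
    thus ?thesis unfolding one by simp
  qed
  have "?X = (q / (2 * of_real K) * of_real (4 * K\<^sup>2 * sqrt (K / pi))) * ?X" unfolding qK by simp
  also have "\<dots> = - \<i> * of_real (4 * K\<^sup>2 * sqrt (K / pi)) * (q * \<i> / (2 * of_real K) * ?X)" by simp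
  finally show ?thesis unfolding 2 by simp
qed


section \<open>Moving the line to the saddle point\<close>

lemma knot_integrand_on_shifted_diagonal:
  assumes "coprime m p"
  shows "knot_integrand m p K (of_real pi * \<i> + \<omega> * of_real t) =
    exp (-K * t\<^sup>2) *\<^sub>R (- ((of_real pi * \<i> + \<omega> * of_real t)\<^sup>2 * tau_quotient m p (\<omega> * of_real t)))"
proof -
  have w2: "(\<omega> * of_real t)\<^sup>2 = \<i> * of_real t ^ 2" by (simp add: power_mult_distrib \<omega>_facts)
  have "\<i> * of_real K * (of_real pi * \<i> + \<omega> * of_real t - of_real pi * \<i>)\<^sup>2 = of_real (-K * t\<^sup>2)"
  proof -
    have "\<i> * of_real K * (\<i> * of_real t ^ 2) = (\<i> * \<i>) * (of_real K * of_real t ^ 2)" by (simp only: mult_ac)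
    thus ?thesis using w2 by simp
  qed
  hence e: "exp (\<i> * of_real K * (of_real pi * \<i> + \<omega> * of_real t - of_real pi * \<i>)\<^sup>2) = of_real (exp (-K * t\<^sup>2))"
    by (simp only: exp_of_real)
  have "tau_quotient m p (of_real pi * \<i> + \<omega> * of_real t) = - tau_quotient m p (\<omega> * of_real t)"
    using tau_quotient_add_pi[OF assms, of "\<omega> * of_real t"] by (simp add: add.commute)
  thus ?thesis unfolding knot_integrand_def e by (simp add: scaleR_conv_of_real mult_ac)
qed

text \<open>Of \<open>(pi \<i> + w)^2 = - pi^2 + 2 pi \<i> w + w^2\<close> the first and last terms multiply the odd function \<open>\<tau>\<close> to odd functions and integrate to \<open>0\<close>.\<close>

lemma saddle_integral:
  assumes "m > 0" "p > 0" "coprime m p" "K > 0"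
  shows "integrable lborel (\<lambda>t. knot_integrand m p K (of_real pi * \<i> + \<omega> * of_real t))" (is ?A)
    and "integrable lborel (\<lambda>t. exp (-K * t\<^sup>2) *\<^sub>R (\<omega> * of_real t * tau_quotient m p (\<omega> * of_real t)))" (is ?B)
    and "(\<integral>t. knot_integrand m p K (of_real pi * \<i> + \<omega> * of_real t) \<partial>lborel) =
      - 2 * of_real pi * \<i> * (\<integral>t. exp (-K * t\<^sup>2) *\<^sub>R (\<omega> * of_real t * tau_quotient m p (\<omega> * of_real t)) \<partial>lborel)" (is ?C)
proof -
  obtain C where C: "\<And>t. norm (tau_quotient m p (\<omega> * of_real t)) \<le> C * exp ((real m + real p) * \<bar>t\<bar>)"
    using tau_quotient_bound_line[OF assms(1-3)] by blast
  show A: ?A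
    unfolding knot_integrand_on_shifted_diagonal[OF assms(3)]
  proof (rule gaussian_integral_exponential_growth(1)[OF assms(4), where C = "pi\<^sup>2 * C" and j = 0 and c = "2 + (real m + real p)"])
    fix t :: real
    have "norm (of_real pi * \<i> + \<omega> * of_real t) \<le> pi + \<bar>t\<bar>"
      by (rule order_trans[OF norm_triangle_ineq]) (simp add: norm_mult \<omega>_facts)
    also have "\<dots> \<le> pi + pi * \<bar>t\<bar>"
      using pi_gt3 by (intro add_left_mono) (simp add: mult_le_cancel_right1)
    also have "\<dots> \<le> pi * exp \<bar>t\<bar>" 
      using mult_left_mono[OF exp_ge_add_one_self[of "\<bar>t\<bar>"], of pi] by (simp add: distrib_left)
    finally have "norm (of_real pi * \<i> + \<omega> * of_real t) ^ 2 \<le> (pi * exp \<bar>t\<bar>) ^ 2"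
      by (rule power_mono) simp
    also have "\<dots> = pi\<^sup>2 * exp (2 * \<bar>t\<bar>)" by (simp add: power_mult_distrib exp_double)
    finally have 1: "norm (of_real pi * \<i> + \<omega> * of_real t) ^ 2 \<le> pi\<^sup>2 * exp (2 * \<bar>t\<bar>)" .
    have "norm (- ((of_real pi * \<i> + \<omega> * of_real t)\<^sup>2 * tau_quotient m p (\<omega> * of_real t)))
       \<le> (pi\<^sup>2 * exp (2 * \<bar>t\<bar>)) * (C * exp ((real m + real p) * \<bar>t\<bar>))"
      unfolding norm_minus_cancel norm_mult norm_power by (intro mult_mono 1 C) auto
    thus "norm (- ((of_real pi * \<i> + \<omega> * of_real t)\<^sup>2 * tau_quotient m p (\<omega> * of_real t)))
       \<le> pi\<^sup>2 * C * t ^ (2 * 0) * exp ((2 + (real m + real p)) * \<bar>t\<bar>)"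
      unfolding distrib_right[of 2] exp_add mult_0_right power_0 by (simp only: mult_1_right mult_ac)
  qed measurable
  show B: ?B
  proof (rule gaussian_integral_exponential_growth(1)[OF assms(4), where C = C and j = 0 and c = "1 + (real m + real p)"])
    fix t :: real
    have "\<bar>t\<bar> \<le> exp \<bar>t\<bar>" using exp_ge_add_one_self[of "\<bar>t\<bar>"] by linarith
    hence "norm (\<omega> * of_real t * tau_quotient m p (\<omega> * of_real t)) \<le> exp \<bar>t\<bar> * (C * exp ((real m + real p) * \<bar>t\<bar>))"
      unfolding norm_mult by (intro mult_mono C) (auto simp: \<omega>_facts)
    thus "norm (\<omega> * of_real t * tau_quotient m p (\<omega> * of_real t)) \<le> C * t ^ (2 * 0) * exp ((1 + (real m + real p)) * \<bar>t\<bar>)"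
      unfolding distrib_right[of 1] exp_add mult_0_right power_0 by (simp only: mult_1_left mult_1_right mult_ac)
  qed measurable
  have "(\<integral>t. knot_integrand m p K (of_real pi * \<i> + \<omega> * of_real t) \<partial>lborel) =
     (\<integral>t. - 2 * of_real pi * \<i> * (exp (-K * t\<^sup>2) *\<^sub>R (\<omega> * of_real t * tau_quotient m p (\<omega> * of_real t))) \<partial>lborel)"
    by (rule integral_eq_of_equal_even_parts[OF A integrable_mult_right[OF B]],
        unfold knot_integrand_on_shifted_diagonal[OF assms(3)])
       (simp add: scaleR_conv_of_real power2_eq_square algebra_simps)
  thus ?C by (simp only: integral_mult_right_zero)
qed

text \<open>The real part of the exponent is \<open>- 2 K Re w (Im w - pi)\<close>. On the vertical sides it is \<open>- K n^2\<close> up to a term linear in \<open>n\<close>, and this beats the exponential growth of \<open>\<tau>\<close>.\<close>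

lemma knot_integrand_strip_bound:
  assumes "m > 0" "p > 0" "K > 0" "x = real n \<or> x = - real n" "n > 0" "0 \<le> s" "s \<le> pi"
  shows "norm (knot_integrand m p K (\<omega> * of_real x + of_real s * \<i>)) \<le>
    (real n + pi)\<^sup>2 * (4 / (real m * real p) * exp ((real m + real p) * real n)) * exp (2 * pi * K * real n - K * (real n)\<^sup>2)"
proof -
  define w where "w = \<omega> * of_real x + of_real s * \<i>"
  have ax: "\<bar>x\<bar> = real n" using assms by auto
  have sq2: "1 \<le> sqrt 2" "sqrt 2 \<le> (2::real)" using real_sqrt_le_mono[of 1 2] real_sqrt_le_mono[of 2 4] by auto
  have re: "Re w = sqrt 2 / 2 * x" "Im w = sqrt 2 / 2 * x + s" by (auto simp: w_def \<omega>_facts)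
  have are: "\<bar>Re w\<bar> = sqrt 2 / 2 * real n" unfolding re by (simp add: abs_mult ax)
  have nw: "norm w \<le> real n + pi"
    unfolding w_def by (rule order_trans[OF norm_triangle_ineq]) (use assms ax in \<open>simp add: norm_mult \<omega>_facts\<close>)
  have ren: "\<bar>Re w\<bar> \<le> real n" unfolding are using mult_right_mono[OF sq2(2), of "real n"] by simp
  have "1 / 2 \<le> \<bar>Re w\<bar>" unfolding are using mult_mono[OF sq2(1), of 1 "real n"] assms by simp
  from tau_quotient_bound[OF assms(1,2) this]
  have "norm (tau_quotient m p w) \<le> 4 / (real m * real p) * exp ((real m + real p) * \<bar>Re w\<bar>)" by simp
  also have "\<dots> \<le> 4 / (real m * real p) * exp ((real m + real p) * real n)"
    using ren by (intro mult_left_mono) (auto intro: mult_left_mono)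
  finally have tau: "norm (tau_quotient m p w) \<le> 4 / (real m * real p) * exp ((real m + real p) * real n)" .
  have "Re (\<i> * of_real K * (w - of_real pi * \<i>)\<^sup>2) = - (2 * K * Re w * (Im w - pi))"
    by (simp add: power2_eq_square)
  also have "\<dots> = - K * (real n)\<^sup>2 + sqrt 2 * K * x * (pi - s)"
  proof -
    have "x * x = (real n)\<^sup>2" using assms(4) by (auto simp: power2_eq_square)
    moreover have "2 * K * Re w * (Im w - pi) = K * (x * x) * (sqrt 2 * sqrt 2 / 2) - sqrt 2 * K * x * (pi - s)"
      unfolding re by (simp add: field_simps)
    ultimately show ?thesis by simp
  qed
  also have "sqrt 2 * K * x * (pi - s) \<le> 2 * K * real n * pi"
  proof -
    have "sqrt 2 * K * x * (pi - s) \<le> sqrt 2 * K * \<bar>x\<bar> * (pi - s)"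
      using assms by (intro mult_right_mono mult_left_mono) auto
    also have "\<dots> \<le> 2 * K * real n * pi" unfolding ax
      using assms sq2 by (intro mult_mono) auto
    finally show ?thesis .
  qed
  finally have ex: "Re (\<i> * of_real K * (w - of_real pi * \<i>)\<^sup>2) \<le> 2 * pi * K * real n - K * (real n)\<^sup>2" by (simp add: mult_ac)
  have "norm (knot_integrand m p K w) = norm w ^ 2 * norm (tau_quotient m p w) * exp (Re (\<i> * of_real K * (w - of_real pi * \<i>)\<^sup>2))"
    by (simp only: knot_integrand_def norm_mult norm_power norm_exp_eq_Re)
  also have "\<dots> \<le> (real n + pi)\<^sup>2 * (4 / (real m * real p) * exp ((real m + real p) * real n)) * exp (2 * pi * K * real n - K * (real n)\<^sup>2)"
    using ex by (intro mult_mono tau power_mono nw mult_nonneg_nonneg) auto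
  finally show ?thesis by (simp add: w_def)
qed

text \<open>The limit formula for the residue at a zero of \<open>sinh (m p w)\<close> also covers the removable case, where \<open>m\<close> or \<open>p\<close> divides \<open>j\<close>: one of the sines is then \<open>0\<close>.\<close>

lemma residue_knot_integrand:
  assumes "m > 0" "p > 0" "coprime m p" "1 \<le> j" "j \<le> m * p - 1"
  shows "residue (knot_integrand m p K) (tau_pole m p j) =
    (tau_pole m p j)\<^sup>2 * exp (\<i> * of_real K * (tau_pole m p j - of_real pi * \<i>)\<^sup>2) *
     (- 2 * (-1) ^ j * of_real (sin (pi * real j / real p)) * of_real (sin (pi * real j / real m)) / (of_nat m * of_nat p))"
proof -
  define q where "q = tau_pole m p j"
  have mp: "of_nat m * of_nat p \<noteq> (0::complex)" using assms by simp
  have mq: "of_nat m * q = \<i> * of_real (pi * real j / real p)" "of_nat p * q = \<i> * of_real (pi * real j / real m)"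
     "of_nat m * of_nat p * q = of_nat j * (of_real pi * \<i>)"
    using assms by (simp_all add: q_def tau_pole_def field_simps)
  have s0: "sinh (of_nat m * of_nat p * q) = 0"
    unfolding mq using sinh_add_pi_multiple[of 0 j] by simp
  have c0: "cosh (of_nat m * of_nat p * q) = (-1) ^ j"
  proof -
    have "cosh (of_nat m * of_nat p * q) = cos (of_real (pi * real j))"
      unfolding mq cosh_conv_cos by (simp add: mult_ac)
    also have "\<dots> = of_real (cos (real j * pi))" unfolding cos_of_real by (simp add: mult.commute)
    finally show ?thesis by simp
  qed
  have si: "sinh (\<i> * of_real x) = \<i> * of_real (sin x)" for x
    by (simp add: sinh_conv_sin sin_of_real mult.assoc[symmetric])
  define F where "F w = w\<^sup>2 * exp (\<i> * of_real K * (w - of_real pi * \<i>)\<^sup>2) * (2 * sinh (of_nat m * w) * sinh (of_nat p * w))" for w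
  have kF: "knot_integrand m p K w = F w / sinh (of_nat m * of_nat p * w)" for w
    by (simp add: F_def knot_integrand_def tau_quotient_def)
  let ?c = "F q / (of_nat m * of_nat p * (-1) ^ j)"
  have "((\<lambda>w. (w - q) / sinh (of_nat m * of_nat p * w)) \<longlongrightarrow> 1 / (of_nat m * of_nat p * (-1) ^ j)) (at q)"
    by (rule lhopital_complex_simple) (use c0 s0 mp in \<open>auto intro!: derivative_eq_intros\<close>)
  moreover have "(F \<longlongrightarrow> F q) (at q)"
    unfolding F_def by (intro tendsto_intros)
  ultimately have "((\<lambda>w. F w * ((w - q) / sinh (of_nat m * of_nat p * w))) \<longlongrightarrow> F q * (1 / (of_nat m * of_nat p * (-1) ^ j))) (at q)"
    by (intro tendsto_mult)
  hence lim: "((\<lambda>w. knot_integrand m p K w * (w - q)) \<longlongrightarrow> ?c) (at q)"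
    unfolding kF by simp
  define S where "S = ball q (pi / (real m * real p))"
  have openS: "open (S - {q})" by (simp add: S_def open_delete)
  have hol: "knot_integrand m p K holomorphic_on S - {q}"
  proof -
    have "tau_quotient m p holomorphic_on S - {q}"
    proof (rule tau_quotient_holomorphic[OF assms(1-3) openS])
      fix n :: int
      let ?z = "of_int n / (of_nat m * of_nat p) * (of_real pi * \<i>) :: complex"
      show "?z \<notin> S - {q}"
      proof (cases "n = int j")
        case True thus ?thesis by (simp add: q_def tau_pole_def)
      next
        case False
        hence "1 \<le> \<bar>real_of_int (int j - n)\<bar>" by linarith
        moreover have "q - ?z = of_real (real_of_int (int j - n) / (real m * real p) * pi) * \<i>"
          by (simp add: q_def tau_pole_def diff_divide_distrib left_diff_distrib mult.assoc)
        hence "dist q ?z = \<bar>real_of_int (int j - n) / (real m * real p) * pi\<bar>"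
          by (simp only: dist_norm norm_mult norm_of_real norm_ii mult_1_right)
        hence "dist q ?z = \<bar>real_of_int (int j - n)\<bar> / (real m * real p) * pi"
          by (simp only: abs_mult abs_divide abs_of_nat) simp
        ultimately have "dist q ?z \<ge> pi / (real m * real p)"
          using assms by (simp add: divide_simps)
        thus ?thesis by (simp add: S_def)
      qed
    qed
    thus ?thesis unfolding knot_integrand_def by (intro holomorphic_intros)
  qed
  have "residue (knot_integrand m p K) q = ?c"
    by (rule residue_simple'[OF _ _ hol lim]) (use assms in \<open>auto simp: S_def\<close>)
  also have "?c = q\<^sup>2 * exp (\<i> * of_real K * (q - of_real pi * \<i>)\<^sup>2) *
     (- 2 * (-1) ^ j * of_real (sin (pi * real j / real p)) * of_real (sin (pi * real j / real m)) / (of_nat m * of_nat p))"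
    unfolding F_def mq(1,2) si by (cases "even j") (simp_all add: mult_ac)
  finally show ?thesis by (simp add: q_def)
qed

lemma knot_contour_shift:
  assumes "m > 0" "p > 0" "coprime m p" "K > 0"
  shows "\<omega> * (\<integral>t. knot_integrand m p K (\<omega> * of_real t) \<partial>lborel) =
     \<omega> * (\<integral>t. knot_integrand m p K (of_real pi * \<i> + \<omega> * of_real t) \<partial>lborel)
      + 2 * of_real pi * \<i> * (\<Sum>j=1..m*p-1. residue (knot_integrand m p K) (tau_pole m p j))"
proof -
  let ?f = "knot_integrand m p K"
  \<comment> \<open>The margin is the distance of consecutive zeros of \<open>sinh (m p w)\<close>, so the widened strip meets no zero beyond those between \<open>0\<close> and \<open>pi \<i>\<close>.\<close>
  define \<delta> where "\<delta> = pi / (real m * real p)"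
  define pts where "pts = tau_pole m p ` {1..m*p-1}"
  define B where "B n = (real n + pi)\<^sup>2 * (4 / (real m * real p) * exp ((real m + real p) * real n)) * exp (2 * pi * K * real n - K * (real n)\<^sup>2)" for n
  have \<delta>: "\<delta> > 0" using assms by (simp add: \<delta>_def)
  have inj: "inj_on (tau_pole m p) {1..m*p-1}"
    using assms by (auto simp: inj_on_def tau_pole_def)
  have pts: "Re q = 0 \<and> 0 < Im q \<and> Im q < pi" if "q \<in> pts" for q
  proof -
    from that obtain j where "j \<in> {1..m*p-1}" and j: "q = tau_pole m p j" unfolding pts_def by blast
    hence j: "q = tau_pole m p j" "1 \<le> j" "j \<le> m * p - 1" by simp_all
    have "j < m * p" using j assms by (metis One_nat_def Suc_pred le_imp_less_Suc nat_0_less_mult_iff)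
    hence "real j < real m * real p" by (metis of_nat_less_iff of_nat_mult)
    hence lt: "0 < real j / (real m * real p)" "real j / (real m * real p) < 1"
      using j(2) assms by simp_all
    have "q = of_real (real j / (real m * real p) * pi) * \<i>" by (simp add: j(1) tau_pole_def)
    hence "Re q = 0" "Im q = real j / (real m * real p) * pi" by (simp_all only: Re_i_times Im_i_times mult.commute[of _ \<i>] Re_complex_of_real Im_complex_of_real minus_zero)
    thus ?thesis using mult_strict_right_mono[OF lt(2) pi_gt_zero] mult_pos_pos[OF lt(1) pi_gt_zero] by simp
  qed
  define S where "S = {w. - \<delta> < Im w - Re w \<and> Im w - Re w < pi + \<delta>}"
  have S_eq: "S = {w. inner (Complex (-1) 1) w > - \<delta>} \<inter> {w. inner (Complex (-1) 1) w < pi + \<delta>}"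
    by (auto simp: S_def inner_complex_def)
  have openS: "open (S - pts)"
    unfolding S_eq pts_def by (intro open_Diff open_Int open_halfspace_lt open_halfspace_gt finite_imp_closed) auto
  have "tau_quotient m p holomorphic_on S - pts"
  proof (rule tau_quotient_holomorphic[OF assms(1-3) openS])
    fix n :: int assume n: "n \<noteq> 0" "n \<noteq> int (m * p)"
    let ?z = "of_int n / (of_nat m * of_nat p) * (of_real pi * \<i>) :: complex"
    have z: "?z = of_real (real_of_int n * \<delta>) * \<i>" by (simp add: \<delta>_def)
    show "?z \<notin> S - pts"
    proof
      assume *: "?z \<in> S - pts"
      hence "- \<delta> < real_of_int n * \<delta>" "real_of_int n * \<delta> < pi + \<delta>" unfolding z by (auto simp: S_def)
      moreover have "pi + \<delta> = (real m * real p + 1) * \<delta>" using assms by (simp add: \<delta>_def field_simps)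
      ultimately have "(-1) * \<delta> < real_of_int n * \<delta>" "real_of_int n * \<delta> < real_of_int (int (m * p) + 1) * \<delta>" by simp_all
      hence "-1 < real_of_int n" "real_of_int n < real_of_int (int (m * p) + 1)"
        using \<delta> by (simp_all only: mult_less_cancel_right_pos)
      hence "0 < n" "n < int (m * p)" using n by linarith+
      moreover from this have "nat n < m * p" by (subst nat_less_iff) auto
      ultimately have "nat n \<in> {1..m*p-1}" "tau_pole m p (nat n) = ?z" by (auto simp: tau_pole_def)
      thus False using * by (metis DiffD2 imageI pts_def)
    qed
  qed
  hence hol: "?f holomorphic_on S - pts"
    unfolding knot_integrand_def by (intro holomorphic_intros)
  have "B \<longlonglongrightarrow> 0" unfolding B_def using assms by real_asymp
  hence "\<omega> * (\<integral>t. ?f (\<omega> * of_real t) \<partial>lborel) - \<omega> * (\<integral>t. ?f (of_real pi * \<i> + \<omega> * of_real t) \<partial>lborel)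
      = 2 * of_real pi * \<i> * (\<Sum>q\<in>pts. residue ?f q)"
  proof (rule diagonal_contour_shift[OF \<delta> _ pts hol[unfolded S_def] knot_integrand_integrable_at_0[OF assms] saddle_integral(1)[OF assms], rotated -1])
    show "norm (?f (\<omega> * of_real (real n) + of_real s * \<i>)) \<le> B n" if "n > 0" "0 \<le> s" "s \<le> pi" for n s
      unfolding B_def by (rule knot_integrand_strip_bound[OF assms(1,2,4) _ that]) simp
    show "norm (?f (\<omega> * of_real (- real n) + of_real s * \<i>)) \<le> B n" if "n > 0" "0 \<le> s" "s \<le> pi" for n s
      unfolding B_def by (rule knot_integrand_strip_bound[OF assms(1,2,4) _ that]) simp
  qed (simp_all add: pts_def)
  moreover have "(\<Sum>q\<in>pts. residue ?f q) = (\<Sum>j=1..m*p-1. residue ?f (tau_pole m p j))"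
    unfolding pts_def by (rule sum.reindex_cong[OF inj]) auto
  ultimately show ?thesis by (simp add: algebra_simps)
qed


section \<open>Expansion at the saddle point\<close>

lemma gaussian_moment_diagonal:
  assumes "K > 0"
  shows "has_bochner_integral lborel (\<lambda>t. exp (-K * t\<^sup>2) *\<^sub>R ((\<omega> * of_real t) ^ (2 * n)))
     (of_real (sqrt (pi / K)) * fact (2 * n) / fact n * (\<i> / (4 * of_real K)) ^ n)"
proof -
  have "has_bochner_integral lborel (\<lambda>t. \<i> ^ n * of_real (exp (-K * t\<^sup>2) * t ^ (2 * n)))
     (\<i> ^ n * of_real (sqrt (pi / K) * fact (2 * n) / (fact n * (4 * K) ^ n)))"
    using gaussian_moment_even[OF assms, of n]
    by (intro has_bochner_integral_mult_right has_bochner_integral_of_real) auto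
  moreover have "(\<omega> * of_real t) ^ (2 * n) = \<i> ^ n * of_real t ^ (2 * n)" for t
    by (simp add: power_mult_distrib power_mult[of \<omega>] \<omega>_facts)
  ultimately show ?thesis by (simp add: scaleR_conv_of_real power_divide mult_ac)
qed

text \<open>Watson's lemma in the case at hand. The factor \<open>exp (c / K)\<close> is the price of the exponential growth of \<open>\<tau>\<close> and is bounded as \<open>K\<close> grows.\<close>

lemma saddle_expansion:
  assumes "m > 0" "p > 0" "coprime m p"
  defines "g \<equiv> (\<lambda>z. z * tau_quotient m p z)"
  obtains C c where "\<And>K. K > 0 \<Longrightarrow>
    norm ((\<integral>t. exp (-K * t\<^sup>2) *\<^sub>R g (\<omega> * of_real t) \<partial>lborel) -
      of_real (sqrt (pi / K)) * (\<Sum>n=1..N. (deriv ^^ (2 * n)) g 0 / fact n * (\<i> / (4 * of_real K)) ^ n))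
     \<le> C * exp (c / K) * sqrt (pi / K) / K ^ Suc N"
proof -
  obtain C c where Cc: "\<And>t. norm (g (\<omega> * of_real t) - (\<Sum>n=1..N. (deriv ^^ (2 * n)) g 0 / fact (2 * n) * (\<omega> * of_real t) ^ (2 * n)))
        \<le> C * t ^ (2 * Suc N) * exp (c * \<bar>t\<bar>)"
    using tau_quotient_even_Taylor[OF assms(1-3), of N] unfolding g_def by blast
  define D where "D = C * sqrt 2 * fact (2 * Suc N) / (fact (Suc N) * 2 ^ Suc N)"
  have "norm ((\<integral>t. exp (-K * t\<^sup>2) *\<^sub>R g (\<omega> * of_real t) \<partial>lborel) -
      of_real (sqrt (pi / K)) * (\<Sum>n=1..N. (deriv ^^ (2 * n)) g 0 / fact n * (\<i> / (4 * of_real K)) ^ n))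
     \<le> D * exp ((c\<^sup>2 / 2) / K) * sqrt (pi / K) / K ^ Suc N" if K: "K > 0" for K
  proof -
    define a where "a n = (deriv ^^ (2 * n)) g 0 / fact (2 * n)" for n
    define R where "R t = g (\<omega> * of_real t) - (\<Sum>n=1..N. a n * (\<omega> * of_real t) ^ (2 * n))" for t
    have "has_bochner_integral lborel
       (\<lambda>t. \<Sum>n=1..N. a n * (exp (-K * t\<^sup>2) *\<^sub>R ((\<omega> * of_real t) ^ (2 * n))))
       (\<Sum>n=1..N. a n * (of_real (sqrt (pi / K)) * fact (2 * n) / fact n * (\<i> / (4 * of_real K)) ^ n))"
      by (intro has_bochner_integral_sum has_bochner_integral_mult_right gaussian_moment_diagonal K)
    also have "(\<Sum>n=1..N. a n * (of_real (sqrt (pi / K)) * fact (2 * n) / fact n * (\<i> / (4 * of_real K)) ^ n)) =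
       of_real (sqrt (pi / K)) * (\<Sum>n=1..N. (deriv ^^ (2 * n)) g 0 / fact n * (\<i> / (4 * of_real K)) ^ n)"
      unfolding sum_distrib_left by (rule sum.cong) (simp_all add: a_def)
    finally have P: "has_bochner_integral lborel
       (\<lambda>t. \<Sum>n=1..N. a n * (exp (-K * t\<^sup>2) *\<^sub>R ((\<omega> * of_real t) ^ (2 * n))))
       (of_real (sqrt (pi / K)) * (\<Sum>n=1..N. (deriv ^^ (2 * n)) g 0 / fact n * (\<i> / (4 * of_real K)) ^ n))" .
    have gi: "integrable lborel (\<lambda>t. exp (-K * t\<^sup>2) *\<^sub>R g (\<omega> * of_real t))"
      using saddle_integral(2)[OF assms(1-3) K] by (simp add: g_def)
    have "(\<integral>t. exp (-K * t\<^sup>2) *\<^sub>R R t \<partial>lborel) = (\<integral>t. exp (-K * t\<^sup>2) *\<^sub>R g (\<omega> * of_real t) -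
        (\<Sum>n=1..N. a n * (exp (-K * t\<^sup>2) *\<^sub>R ((\<omega> * of_real t) ^ (2 * n)))) \<partial>lborel)"
      by (simp add: R_def scaleR_right_diff_distrib scaleR_right.sum)
    also have "\<dots> = (\<integral>t. exp (-K * t\<^sup>2) *\<^sub>R g (\<omega> * of_real t) \<partial>lborel) -
       of_real (sqrt (pi / K)) * (\<Sum>n=1..N. (deriv ^^ (2 * n)) g 0 / fact n * (\<i> / (4 * of_real K)) ^ n)"
      using Bochner_Integration.integral_diff[OF gi integrable.intros[OF P]] has_bochner_integral_integral_eq[OF P] by simp
    finally have eq: "(\<integral>t. exp (-K * t\<^sup>2) *\<^sub>R R t \<partial>lborel) = \<dots>" .
    have "norm (\<integral>t. exp (-K * t\<^sup>2) *\<^sub>R R t \<partial>lborel) \<le>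
      C * exp (c\<^sup>2 / (2 * K)) * (sqrt (2 * pi / K) * fact (2 * Suc N) / (fact (Suc N) * (2 * K) ^ Suc N))"
    proof (rule gaussian_integral_exponential_growth(2)[OF K])
      show "R \<in> borel_measurable borel" unfolding R_def g_def by measurable
      show "norm (R t) \<le> C * t ^ (2 * Suc N) * exp (c * \<bar>t\<bar>)" for t
        using Cc[of t] by (simp only: R_def a_def)
    qed
    also have "sqrt (2 * pi / K) = sqrt 2 * sqrt (pi / K)" by (simp flip: real_sqrt_mult)
    also have "C * exp (c\<^sup>2 / (2 * K)) * (sqrt 2 * sqrt (pi / K) * fact (2 * Suc N) / (fact (Suc N) * (2 * K) ^ Suc N))
       = D * exp ((c\<^sup>2 / 2) / K) * sqrt (pi / K) / K ^ Suc N"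
      unfolding D_def power_mult_distrib by (simp add: mult_ac del: fact_Suc power_Suc)
    finally show ?thesis unfolding eq .
  qed
  thus ?thesis by (rule that)
qed

text \<open>The exponent at the pole is \<open>\<i> pi k j\<close> plus the quadratic phase, so together with the factor \<open>(-1)^j\<close> of the residue the sign becomes \<open>(-1)^((k-1) j)\<close>. The amplitude is a power of \<open>y = 2 m p / k\<close> because \<open>K = (m p)^2 / (pi y)\<close>.\<close>

lemma residue_contribution:
  assumes "m > 0" "p > 0" "coprime m p" "k > 0" "1 \<le> j" "j \<le> m * p - 1"
  defines "K \<equiv> real m * real p * real k / (2 * pi)"
  shows "of_real (K / (2 * pi) * sqrt (K / pi)) * exp (\<i> * of_real (K * pi\<^sup>2)) / \<omega> *
     (2 * of_real pi * \<i> * residue (knot_integrand m p K) (tau_pole m p j)) = hyp_spec_term m p k j"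
proof -
  define q where "q = tau_pole m p j"
  define M where "M = real m * real p"
  have M: "M > 0" using assms by (simp add: M_def)
  have K: "K = M * real k / (2 * pi)" "K > 0" using assms M by (simp_all add: K_def M_def)
  have q: "q = of_real (real j / M * pi) * \<i>" by (simp add: q_def tau_pole_def M_def)
  have q2: "q\<^sup>2 = of_real (- ((real j / M * pi)\<^sup>2))"
    unfolding q by (simp add: power_mult_distrib power_divide)
  have e: "exp (\<i> * of_real (K * pi\<^sup>2)) * exp (\<i> * of_real K * (q - of_real pi * \<i>)\<^sup>2) =
     (-1) ^ (k * j) * exp (- (\<i> * of_real pi * of_nat k * (of_nat j)\<^sup>2 / (2 * of_nat m * of_nat p)))"
  proof -
    have "(q - of_real pi * \<i>)\<^sup>2 = of_real (- ((real j / M * pi - pi)\<^sup>2))"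
    proof -
      have "q - of_real pi * \<i> = of_real (real j / M * pi - pi) * \<i>" unfolding q by (simp add: left_diff_distrib)
      thus ?thesis by (simp only: power_mult_distrib i_squared) simp
    qed
    hence "\<i> * of_real (K * pi\<^sup>2) + \<i> * of_real K * (q - of_real pi * \<i>)\<^sup>2
        = \<i> * of_real (K * pi\<^sup>2 - K * (real j / M * pi - pi)\<^sup>2)"
      by (simp only: of_real_diff of_real_mult of_real_minus) (simp add: algebra_simps)
    also have "K * pi\<^sup>2 - K * (real j / M * pi - pi)\<^sup>2 = pi * real (k * j) - pi * real k * (real j)\<^sup>2 / (2 * M)"
      unfolding K(1) using M by (simp add: field_simps power2_eq_square)
    finally have "exp (\<i> * of_real (K * pi\<^sup>2)) * exp (\<i> * of_real K * (q - of_real pi * \<i>)\<^sup>2) =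
       exp (\<i> * of_real (pi * real (k * j) - pi * real k * (real j)\<^sup>2 / (2 * M)))"
      by (simp only: exp_add[symmetric])
    also have "\<i> * of_real (pi * real (k * j) - pi * real k * (real j)\<^sup>2 / (2 * M)) =
       of_nat (k * j) * (\<i> * of_real pi) + (- (\<i> * of_real pi * of_nat k * (of_nat j)\<^sup>2 / (2 * of_nat m * of_nat p)))"
      by (simp add: M_def algebra_simps)
    also have "exp \<dots> = (-1) ^ (k * j) * exp (- (\<i> * of_real pi * of_nat k * (of_nat j)\<^sup>2 / (2 * of_nat m * of_nat p)))"
      unfolding exp_add exp_of_nat_mult by (simp add: mult.commute[of \<i>])
    finally show ?thesis .
  qed
  have \<omega>: "\<i> / \<omega> = exp (\<i> * of_real pi / 4)"
  proof -
    have "\<i> / \<omega> = \<omega> ^ 2 / \<omega>" by (simp add: \<omega>_facts)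
    also have "\<dots> = \<omega>" using \<omega>_facts(5) by (simp add: power2_eq_square)
    also have "\<dots> = exp (\<i> * of_real pi / 4)" by (simp add: \<omega>_def cis_conv_exp)
    finally show ?thesis .
  qed
  have sign: "(-1) ^ (k * j) * (-1) ^ j = ((-1) ^ ((k - 1) * j) :: complex)"
  proof -
    have "k * j + j = (k - 1) * j + 2 * j" using \<open>k > 0\<close> by (cases k) auto
    hence "(-1) ^ (k * j) * (-1) ^ j = ((-1) ^ ((k - 1) * j + 2 * j) :: complex)" by (metis power_add)
    thus ?thesis by (simp add: power_add power_mult)
  qed
  have amp: "K / (2 * pi) * sqrt (K / pi) * (2 * pi) * (real j / M * pi)\<^sup>2 * 2 / M = 2 * (2 * M / real k) powr (-3/2) * (real j)\<^sup>2"
  proof -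
    define y where "y = 2 * M / real k"
    have y: "y > 0" using M assms by (simp add: y_def)
    have kM: "real k = 2 * M / y" using M assms by (simp add: y_def)
    have Ky: "K = M\<^sup>2 / (y * pi)" unfolding K(1) kM using M y by (simp add: field_simps power2_eq_square)
    have "K / pi = (M / pi)\<^sup>2 / y" unfolding Ky using M y by (simp add: field_simps power2_eq_square)
    hence "sqrt (K / pi) = M / pi / sqrt y" using M by (simp add: real_sqrt_divide)
    hence "K / (2 * pi) * sqrt (K / pi) * (2 * pi) * (real j / M * pi)\<^sup>2 * 2 / M = 2 * (1 / (y * sqrt y)) * (real j)\<^sup>2"
      unfolding Ky using M y by (simp add: field_simps power2_eq_square)
    also have "1 / (y * sqrt y) = y powr (-3/2)"
    proof -
      have "y powr (-3/2) * (y powr 1 * y powr (1/2)) = y powr (-3/2 + (1 + 1/2))" by (simp only: powr_add)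
      also have "\<dots> = 1" using y by simp
      finally have "y powr (-3/2) * (y powr 1 * y powr (1/2)) = 1" .
      thus ?thesis using y by (simp add: powr_half_sqrt field_simps)
    qed
    finally show ?thesis by (simp add: y_def)
  qed
  have "of_real (K / (2 * pi) * sqrt (K / pi)) * exp (\<i> * of_real (K * pi\<^sup>2)) / \<omega> *
     (2 * of_real pi * \<i> * residue (knot_integrand m p K) (tau_pole m p j)) =
     of_real (K / (2 * pi) * sqrt (K / pi) * (2 * pi) * (real j / M * pi)\<^sup>2 * 2 / M) *
      (exp (\<i> * of_real (K * pi\<^sup>2)) * exp (\<i> * of_real K * (q - of_real pi * \<i>)\<^sup>2)) * (\<i> / \<omega>) * (-1) ^ j *
      of_real (sin (pi * real j / real m)) * of_real (sin (pi * real j / real p))"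
  proof -
    have alg: "of_real a * E / w * (2 * of_real pi * \<i> * (of_real (- b) * X * (- 2 * s * sp * sm / of_real M))) =
        of_real (a * (2 * pi) * b * 2 / M) * (E * X) * (\<i> / w) * s * sm * sp"
      for a b :: real and E X s sp sm w :: complex
      by (simp add: mult_ac)
    have mM: "of_nat m * of_nat p = complex_of_real M" by (simp add: M_def)
    show ?thesis
      unfolding q_def[symmetric] residue_knot_integrand[OF assms(1-3,5,6), folded q_def] q2 mM by (rule alg)
  qed
  also have "\<dots> = 2 * of_real ((2 * M / real k) powr (-3/2)) * exp (\<i> * of_real pi / 4) * ((-1) ^ (k * j) * (-1) ^ j) *
      exp (- (\<i> * of_real pi * of_nat k * (of_nat j)\<^sup>2 / (2 * of_nat m * of_nat p))) * (of_nat j)\<^sup>2 *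
      of_real (sin (pi * real j / real m)) * of_real (sin (pi * real j / real p))"
    unfolding amp e \<omega> by (simp add: mult_ac)
  finally show ?thesis unfolding sign hyp_spec_term_def by (simp add: M_def mult.assoc)
qed

text \<open>The contour shift gives an identity for each single \<open>k\<close>: the finite sum is exact, and only the integral at the saddle point has to be expanded.\<close>

lemma hyp_spec_exact:
  assumes "m > 0" "p > 0" "coprime m p" "k > 1"
  defines "K \<equiv> real m * real p * real k / (2 * pi)"
  shows "hyp_spec m p k * exp (\<i> * of_real pi / (2 * of_nat k) * (of_nat m / of_nat p + of_nat p / of_nat m)) =
    (\<Sum>j=1..m*p-1. hyp_spec_term m p k j) -
     \<i> * of_real (K * sqrt (K / pi)) * exp (\<i> * of_real (K * pi\<^sup>2)) *
      (\<integral>t. exp (-K * t\<^sup>2) *\<^sub>R (\<omega> * of_real t * tau_quotient m p (\<omega> * of_real t)) \<partial>lborel)"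
proof -
  have K: "K > 0" using assms by (simp add: K_def)
  let ?E = "exp (\<i> * of_real (K * pi\<^sup>2))"
  let ?I0 = "\<integral>t. knot_integrand m p K (\<omega> * of_real t) \<partial>lborel"
  let ?J = "\<integral>t. exp (-K * t\<^sup>2) *\<^sub>R (\<omega> * of_real t * tau_quotient m p (\<omega> * of_real t)) \<partial>lborel"
  define A where "A = of_real (K / (2 * pi) * sqrt (K / pi)) * ?E / \<omega>"
  have "hyp_spec m p k * exp (\<i> * of_real pi / (2 * of_nat k) * (of_nat m / of_nat p + of_nat p / of_nat m)) =
    - 1 / (4 * of_nat m * of_nat p * of_nat k) * (- 4 * of_real (K\<^sup>2 * sqrt (K / pi)) * ?E * ?I0)"
    unfolding hyp_spec_eq_quadratic_gauss_sum[OF assms(1,2,4,3)]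
    using quadratic_gauss_sum_eq_integral[OF assms(1-3), of k] assms(4) by (simp add: K_def)
  also have "\<dots> = A * (\<omega> * ?I0)"
  proof -
    have "of_nat m * of_nat p * of_nat k = complex_of_real (2 * pi * K)" by (simp add: K_def)
    thus ?thesis unfolding A_def using K \<omega>_facts(5) by (simp add: field_simps power2_eq_square)
  qed
  also have "\<omega> * ?I0 = \<omega> * (- 2 * of_real pi * \<i> * ?J) + (\<Sum>j=1..m*p-1. 2 * of_real pi * \<i> * residue (knot_integrand m p K) (tau_pole m p j))"
    unfolding knot_contour_shift[OF assms(1-3) K] saddle_integral(3)[OF assms(1-3) K] sum_distrib_left ..
  also have "A * \<dots> = A * (\<omega> * (- 2 * of_real pi * \<i> * ?J)) + (\<Sum>j=1..m*p-1. A * (2 * of_real pi * \<i> * residue (knot_integrand m p K) (tau_pole m p j)))"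
    by (simp only: distrib_left sum_distrib_left)
  also have "(\<Sum>j=1..m*p-1. A * (2 * of_real pi * \<i> * residue (knot_integrand m p K) (tau_pole m p j))) = (\<Sum>j=1..m*p-1. hyp_spec_term m p k j)"
    by (rule sum.cong) (use residue_contribution[OF assms(1-3)] assms(4) in \<open>auto simp: A_def K_def\<close>)
  also have "A * (\<omega> * (- 2 * of_real pi * \<i> * ?J)) = - (\<i> * of_real (K * sqrt (K / pi)) * ?E * ?J)"
    unfolding A_def using \<omega>_facts(5) by (simp add: field_simps)
  finally show ?thesis by simp
qed

lemma hyp_spec_inf_partial_eq:
  assumes "m > 0" "p > 0" "coprime m p" "k > 0"
  defines "K \<equiv> real m * real p * real k / (2 * pi)"
  shows "hyp_spec_inf_partial m p N k =
    - \<i> * of_real (K * sqrt (K / pi)) * exp (\<i> * of_real (K * pi\<^sup>2)) *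
     (of_real (sqrt (pi / K)) * (\<Sum>n=1..N. (deriv ^^ (2 * n)) (\<lambda>z. z * tau_quotient m p z) 0 / fact n * (\<i> / (4 * of_real K)) ^ n))"
proof -
  have K: "K > 0" using assms by (simp add: K_def)
  define y where "y = \<i> / (4 * complex_of_real K)"
  have d: "(deriv ^^ n) (\<lambda>x. x * torus_tau m p x) 0 = (deriv ^^ n) (\<lambda>z. z * tau_quotient m p z) 0" for n
    by (rule higher_deriv_cong_ev[OF eventually_mono[OF torus_tau_eventually[OF assms(1-3)]]]) auto
  have y: "\<i> * of_real pi / (2 * of_nat k * of_nat m * of_nat p) = y"
    unfolding y_def K_def using assms by (simp add: field_simps)
  have E: "\<i> * of_real pi * of_nat k * of_nat m * of_nat p / 2 = \<i> * of_real (K * pi\<^sup>2)"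
    by (simp add: K_def power2_eq_square)
  have pw: "1 / 4 * y ^ (n - 1) = - \<i> * of_real K * y ^ n" if "n \<in> {1..N}" for n
  proof -
    have "y ^ n = y * y ^ (n - 1)" using that by (cases n) auto
    thus ?thesis using K by (simp add: y_def)
  qed
  have "sqrt (K / pi) * sqrt (pi / K) = 1" using K by (simp flip: real_sqrt_mult)
  hence one: "complex_of_real (K * sqrt (K / pi)) * of_real (sqrt (pi / K)) = of_real K"
    by (metis mult.assoc mult.right_neutral of_real_mult)
  have "hyp_spec_inf_partial m p N k = exp (\<i> * of_real (K * pi\<^sup>2)) *
      (\<Sum>n=1..N. (deriv ^^ (2 * n)) (\<lambda>z. z * tau_quotient m p z) 0 / fact n * (1 / 4 * y ^ (n - 1)))"
    unfolding hyp_spec_inf_partial_def d y E by (simp add: sum_distrib_left sum_distrib_right mult_ac)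
  also have "(\<Sum>n=1..N. (deriv ^^ (2 * n)) (\<lambda>z. z * tau_quotient m p z) 0 / fact n * (1 / 4 * y ^ (n - 1))) =
      (\<Sum>n=1..N. (deriv ^^ (2 * n)) (\<lambda>z. z * tau_quotient m p z) 0 / fact n * (- \<i> * of_real K * y ^ n))"
    by (rule sum.cong[OF refl]) (simp only: pw)
  also have "\<dots> = - \<i> * of_real K * (\<Sum>n=1..N. (deriv ^^ (2 * n)) (\<lambda>z. z * tau_quotient m p z) 0 / fact n * y ^ n)"
    unfolding sum_distrib_left by (rule sum.cong) (simp_all add: mult_ac)
  also have "exp (\<i> * of_real (K * pi\<^sup>2)) * (- \<i> * of_real K * S) =
      - \<i> * of_real (K * sqrt (K / pi)) * exp (\<i> * of_real (K * pi\<^sup>2)) * (of_real (sqrt (pi / K)) * S)" for S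
    unfolding one[symmetric] by (simp only: mult_ac)
  finally show ?thesis unfolding y_def .
qed

theorem mainTheorem1:
  fixes m p :: nat
  assumes "m > 0" and "p > 0" and "coprime m p"
  shows "\<forall>N\<ge>1.
    (\<lambda>k::nat.
        hyp_spec m p k
          * exp (\<i> * of_real pi / (2 * of_nat k) * (of_nat m / of_nat p + of_nat p / of_nat m))
        - ((\<Sum>j=1..m*p-1. hyp_spec_term m p k j) + hyp_spec_inf_partial m p N k))
      \<in> O(\<lambda>k. 1 / of_nat k ^ N)"
proof (intro allI impI)
  fix N :: nat
  define \<kappa> where "\<kappa> = real m * real p / (2 * pi)"
  have \<kappa>: "\<kappa> > 0" using assms by (simp add: \<kappa>_def)
  define g where "g = (\<lambda>z. z * tau_quotient m p z)"
  obtain C c where C: "\<And>K. K > 0 \<Longrightarrow>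
    norm ((\<integral>t. exp (-K * t\<^sup>2) *\<^sub>R g (\<omega> * of_real t) \<partial>lborel) -
      of_real (sqrt (pi / K)) * (\<Sum>n=1..N. (deriv ^^ (2 * n)) g 0 / fact n * (\<i> / (4 * of_real K)) ^ n))
     \<le> C * exp (c / K) * sqrt (pi / K) / K ^ Suc N"
    using saddle_expansion[OF assms, of N] unfolding g_def by blast
  have C0: "C \<ge> 0"
  proof -
    have "0 \<le> C * exp (c / 1) * sqrt (pi / 1) / 1 ^ Suc N" by (rule order_trans[OF norm_ge_zero C]) simp
    thus ?thesis using pi_gt_zero by (auto simp: zero_le_mult_iff)
  qed
  show "(\<lambda>k::nat.
        hyp_spec m p k
          * exp (\<i> * of_real pi / (2 * of_nat k) * (of_nat m / of_nat p + of_nat p / of_nat m))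
        - ((\<Sum>j=1..m*p-1. hyp_spec_term m p k j) + hyp_spec_inf_partial m p N k))
      \<in> O(\<lambda>k. 1 / of_nat k ^ N)"
  proof (rule bigoI[where c = "C * exp (\<bar>c\<bar> / \<kappa>) / \<kappa> ^ N"], rule eventually_mono[OF eventually_gt_at_top[of 1]])
    fix k :: nat assume k: "k > 1"
    define K where "K = real m * real p * real k / (2 * pi)"
    have Kk: "K = \<kappa> * real k" by (simp add: K_def \<kappa>_def)
    have K: "K > 0" using k \<kappa> by (simp add: Kk)
    let ?J = "\<integral>t. exp (-K * t\<^sup>2) *\<^sub>R g (\<omega> * of_real t) \<partial>lborel"
    let ?T = "of_real (sqrt (pi / K)) * (\<Sum>n=1..N. (deriv ^^ (2 * n)) g 0 / fact n * (\<i> / (4 * of_real K)) ^ n)"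
    let ?B = "\<i> * of_real (K * sqrt (K / pi)) * exp (\<i> * of_real (K * pi\<^sup>2))"
    have eq: "hyp_spec m p k
          * exp (\<i> * of_real pi / (2 * of_nat k) * (of_nat m / of_nat p + of_nat p / of_nat m))
        - ((\<Sum>j=1..m*p-1. hyp_spec_term m p k j) + hyp_spec_inf_partial m p N k) = - ?B * (?J - ?T)"
      using hyp_spec_exact[OF assms k] hyp_spec_inf_partial_eq[OF assms, of k N] k
      unfolding K_def[symmetric] g_def by (simp add: algebra_simps)
    have "norm (exp (\<i> * complex_of_real (K * pi\<^sup>2))) = 1" by (simp only: norm_exp_i_times)
    hence nB: "norm (- ?B) = K * sqrt (K / pi)" using K by (simp add: norm_mult)
    have sq: "sqrt (K / pi) * sqrt (pi / K) = 1" using K by (simp flip: real_sqrt_mult)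
    have "norm (- ?B * (?J - ?T)) \<le> (K * sqrt (K / pi)) * (C * exp (c / K) * sqrt (pi / K) / K ^ Suc N)"
      unfolding norm_mult[of "- ?B"] nB using K by (intro mult_left_mono C) auto
    also have "\<dots> = (sqrt (K / pi) * sqrt (pi / K)) * (C * exp (c / K) / K ^ N)"
      using K by (simp add: field_simps)
    also have "\<dots> = C * exp (c / K) / K ^ N" unfolding sq by simp
    also have "\<dots> \<le> C * exp (\<bar>c\<bar> / \<kappa>) / K ^ N"
    proof -
      have "c / K \<le> \<bar>c\<bar> / K" using K by (simp add: divide_right_mono)
      also have "\<dots> \<le> \<bar>c\<bar> / \<kappa>" using \<kappa> k by (intro divide_left_mono) (auto simp: Kk)
      finally show ?thesis using C0 K by (intro divide_right_mono mult_left_mono) auto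
    qed
    also have "\<dots> = C * exp (\<bar>c\<bar> / \<kappa>) / \<kappa> ^ N * norm (1 / of_nat k ^ N :: complex)"
      by (simp add: Kk power_mult_distrib norm_divide norm_power)
    finally show "norm (hyp_spec m p k
          * exp (\<i> * of_real pi / (2 * of_nat k) * (of_nat m / of_nat p + of_nat p / of_nat m))
        - ((\<Sum>j=1..m*p-1. hyp_spec_term m p k j) + hyp_spec_inf_partial m p N k))
       \<le> C * exp (\<bar>c\<bar> / \<kappa>) / \<kappa> ^ N * norm (1 / of_nat k ^ N :: complex)"
      unfolding eq .
  qed
qed

end
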